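(* Let $m\in\mathbb Z_{\ge0}$ and $n\in\frac12\mathbb Z_{>0}$, and let $f$ be a polynomial in the variables $\mathbf z_{\mathcal N(m)^{\preccurlyeq n}}=\{z_b\mid b\in\mathcal N(m)^{\preccurlyeq n}\}$ with integral coefficients. Then $f\in R_{\mathcal N(m)^{\preccurlyeq n}}$ if and only if (1) $f$ is symmetric with respect to $\{\,z_i\mid i=-m,\dots,-1\,\}$, and (2) $f|_{z_r=-z_s=t}$ is independent of $t$, for $(r,s)=(-1,\frac12)$ or $s=r+\frac12$ with $r\in\frac12\mathbb Z_{>0}$, where $r,s\in\mathcal N(m)^{\preccurlyeq n}$.
   Context: $\mathcal N(m)=\{-m<\cdots<-1<\frac12<1<\frac32<2<\cdots\}$; integers are even, elements of $\frac12+\mathbb Z_{\ge0}$ are odd. $\mathcal S=\mathcal N(m)^{\preccurlyeq n}$ is the subset of elements $\le n$. $t$ is an indeterminate; $|_{z_r=-z_s=t}$ means substituting $z_r=t$, $z_s=-t$. $P=\bigoplus_{b\in\mathcal S}\mathbb Z\epsilon_b$ with $(\epsilon_a,\epsilon_b)=(-1)^{|a|}\delta_{ab}$. Simple roots: $\alpha_i=\epsilon_{i-1}-\epsilon_i$ for $-m+1\le i\le-1$, $\alpha_0=\epsilon_{-1}-\epsilon_{1/2}$ (if $m\ge1$) and $\alpha_r=\epsilon_r-\epsilon_{r+\frac12}$ for $r\in\frac12\mathbb Z_{>0}$ with $r+\frac12\le n$. Crystal operators on the set $\mathbf W_{\mathcal S}$ of finite words in $\mathcal S$ (including the empty word, on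 which all $e_i,f_i$ give $\mathbf 0$): a word $w_1\cdots w_r$ is identified with $w_1\otimes\cdots\otimes w_r$. On letters: $\mathrm{wt}(b)=\epsilon_b$, $f_i b=b'$ and $e_ib'=b$ iff $\alpha_i=\epsilon_b-\epsilon_{b'}$, otherwise $\mathbf 0$ (formal symbol); $\varepsilon_i(b)$ (resp. $\varphi_i(b)$) is $1$ if $e_ib\ne\mathbf 0$ (resp. $f_ib\neq\mathbf 0$), else $0$. Tensor product rule: $\mathrm{wt}$ is additive. For $i\in\mathbb Z_{\ge0}$: $e_i,f_i$ act on $b_1$ in $b_1\otimes b_2$ if $(\alpha_i,\mathrm{wt}(b_1))\ne0$, otherwise on $b_2$. For $i\in\frac12+\mathbb Z_{\ge0}$: they act on $b_2$ if $(\alpha_i,\mathrm{wt}(b_2))\neq0$, otherwise on $b_1$. In both cases $\varepsilon_i,\varphi_i$ are those of the factor acted on. For $i\le-1$: $e_i(b_1\otimes b_2)=e_ib_1\otimes b_2$ if $\varphi_i(b_1)\ge\varepsilon_i(b_2)$, else $b_1\otimes e_ib_2$; $f_i(b_1\otimes b_2)=f_ib_1\otimes b_2$ if $\varphi_i(b_1)>\varepsilon_i(b_2)$, else $b_1\otimes f_ib_2$; $\varepsilon_i(b_1\otimes b_2)=\max\{\varepsilon_i(b_1),\varepsilon_i(b_2)-(\alpha_i,\mathrm{wt}(b_1))\}$, $\varphi_i(b_1\otimes b_2)=\max\{\varphi_i(b_1)+(\alpha_i,\mathrm{wt}(b_2)),\varphi_i(b_2)\}$. $\mathbf W_{\mathcal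 S}$ is a colored oriented graph ($w\xrightarrow{i}w'$ iff $w'=f_iw$); $C(w)$ is the connected component of $w$. For $\mu=\sum\mu_b\epsilon_b$, $\mathbf z^\mu=\prod_bz_b^{\mu_b}$. $\mathrm{ch}\,C=\sum_{w\in C}\mathbf z^{\mathrm{wt}(w)}$, and $R_{\mathcal S}$ is the $\mathbb Z$-span of $\{\mathrm{ch}\,C(w)\mid w\in\mathbf W_{\mathcal S}\}$. *)

theory Defs
  imports
    "HOL-Combinatorics.Permutations"
    "HOL-Computational_Algebra.Polynomial"
    "HOL-Library.Poly_Mapping"
begin

definition letters :: "nat \<Rightarrow> rat set" where
  "letters m = {b. b \<in> \<int> \<and> - of_nat m \<le> b \<and> b \<le> -1} \<union> {b. 2 * b \<in> \<int> \<and> 0 < b}"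

definition letters_upto :: "nat \<Rightarrow> rat \<Rightarrow> rat set" where
  "letters_upto m n = {b \<in> letters m. b \<le> n}"

definition words :: "nat \<Rightarrow> rat \<Rightarrow> rat list set" where
  "words m n = lists (letters_upto m n)"


text \<open>Weights are finitely supported integer-valued functions on rational numbers.
  An element of \<open>letters m\<close> is even iff it is an integer.\<close>

type_synonym weight = "rat \<Rightarrow>\<^sub>0 int"

definition \<epsilon> :: "rat \<Rightarrow> weight" where
  "\<epsilon> b = Poly_Mapping.single b 1"

definition parity_sign :: "rat \<Rightarrow> int" where
  "parity_sign b = (if b \<in> \<int> then 1 else -1)"

definition pairing :: "weight \<Rightarrow> weight \<Rightarrow> int" where
  "pairing \<nu> \<mu> =
     (\<Sum>b\<in>Poly_Mapping.keys \<nu>.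
        parity_sign b * Poly_Mapping.lookup \<nu> b * Poly_Mapping.lookup \<mu> b)"

definition simple_indices :: "nat \<Rightarrow> rat \<Rightarrow> rat set" where
  "simple_indices m n =
     {i. i \<in> \<int> \<and> - of_nat m + 1 \<le> i \<and> i \<le> -1} \<union>
     {i. i = 0 \<and> 1 \<le> m} \<union>
     {i. 2 * i \<in> \<int> \<and> 0 < i \<and> i + 1/2 \<le> n}"

definition simple_root :: "rat \<Rightarrow> weight" where
  "simple_root i =
     (if i < 0 then \<epsilon> (i - 1) - \<epsilon> i
      else if i = 0 then \<epsilon> (-1) - \<epsilon> (1/2)
      else \<epsilon> i - \<epsilon> (i + 1/2))"


text \<open>The formal symbol \<open>\<zero>\<close> of the crystal operators is \<open>None\<close>.\<close>

definition f_letter :: "rat \<Rightarrow> rat \<Rightarrow> rat option" where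
  "f_letter i b =
     (if \<exists>b'. simple_root i = \<epsilon> b - \<epsilon> b' then Some (THE b'. simple_root i = \<epsilon> b - \<epsilon> b')
      else None)"

definition e_letter :: "rat \<Rightarrow> rat \<Rightarrow> rat option" where
  "e_letter i b' =
     (if \<exists>b. simple_root i = \<epsilon> b - \<epsilon> b' then Some (THE b. simple_root i = \<epsilon> b - \<epsilon> b')
      else None)"

definition eps_letter :: "rat \<Rightarrow> rat \<Rightarrow> int" where
  "eps_letter i b = (if e_letter i b \<noteq> None then 1 else 0)"

definition phi_letter :: "rat \<Rightarrow> rat \<Rightarrow> int" where
  "phi_letter i b = (if f_letter i b \<noteq> None then 1 else 0)"

definition wt :: "rat list \<Rightarrow> weight" where
  "wt w = (\<Sum>b\<leftarrow>w. \<epsilon> b)"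


text \<open>The word \<open>b\<^sub>1 \<dots> b\<^sub>r\<close> is read as \<open>b\<^sub>1 \<otimes> (b\<^sub>2 \<otimes> (\<dots> \<otimes> b\<^sub>r))\<close>, and the functions on words apply
  the rule for \<open>u \<otimes> v\<close> to \<open>u = b\<^sub>1\<close> and \<open>v = b\<^sub>2 \<dots> b\<^sub>r\<close>.  The bracketing does not matter; see
  \<open>f_word_append\<close> below.  The predicate \<open>acts_left\<close> says, for \<open>i \<ge> 0\<close>, which tensor factor the
  operators of index \<open>i\<close> act on, given the weights of the two factors.\<close>

definition acts_left :: "rat \<Rightarrow> weight \<Rightarrow> weight \<Rightarrow> bool" where
  "acts_left i \<mu> \<nu> =
     (if i \<in> \<int> then pairing (simple_root i) \<mu> \<noteq> 0 else pairing (simple_root i) \<nu> = 0)"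

fun eps_word :: "rat \<Rightarrow> rat list \<Rightarrow> int" where
  "eps_word i [] = 0"
| "eps_word i [b] = eps_letter i b"
| "eps_word i (b # c # w) =
     (let v = c # w in
      if i < 0 then max (eps_letter i b) (eps_word i v - pairing (simple_root i) (wt [b]))
      else if acts_left i (wt [b]) (wt v) then eps_letter i b else eps_word i v)"

fun phi_word :: "rat \<Rightarrow> rat list \<Rightarrow> int" where
  "phi_word i [] = 0"
| "phi_word i [b] = phi_letter i b"
| "phi_word i (b # c # w) =
     (let v = c # w in
      if i < 0 then max (phi_letter i b + pairing (simple_root i) (wt v)) (phi_word i v)
      else if acts_left i (wt [b]) (wt v) then phi_letter i b else phi_word i v)"

fun e_word :: "rat \<Rightarrow> rat list \<Rightarrow> rat list option" where
  "e_word i [] = None"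
| "e_word i [b] = map_option (\<lambda>b'. [b']) (e_letter i b)"
| "e_word i (b # c # w) =
     (let v = c # w in
      if (if i < 0 then phi_letter i b \<ge> eps_word i v else acts_left i (wt [b]) (wt v))
      then map_option (\<lambda>b'. b' # v) (e_letter i b)
      else map_option (\<lambda>v'. b # v') (e_word i v))"

fun f_word :: "rat \<Rightarrow> rat list \<Rightarrow> rat list option" where
  "f_word i [] = None"
| "f_word i [b] = map_option (\<lambda>b'. [b']) (f_letter i b)"
| "f_word i (b # c # w) =
     (let v = c # w in
      if (if i < 0 then phi_letter i b > eps_word i v else acts_left i (wt [b]) (wt v))
      then map_option (\<lambda>b'. b' # v) (f_letter i b)
      else map_option (\<lambda>v'. b # v') (f_word i v))"

definition crystal_edges :: "nat \<Rightarrow> rat \<Rightarrow> (rat list \<times> rat list) set" where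
  "crystal_edges m n =
     {(w, w'). w \<in> words m n \<and> w' \<in> words m n \<and> (\<exists>i\<in>simple_indices m n. f_word i w = Some w')}"

definition component :: "nat \<Rightarrow> rat \<Rightarrow> rat list \<Rightarrow> rat list set" where
  "component m n w = {w'. (w, w') \<in> (crystal_edges m n \<union> (crystal_edges m n)\<inverse>)\<^sup>*}"


text \<open>Polynomials with integer coefficients in the variables \<open>z\<^sub>b\<close>, for rational \<open>b\<close>: finitely
  supported functions from exponent vectors to coefficients.  Their product is the convolution
  product of \<open>Poly_Mapping\<close>.\<close>

type_synonym zpoly = "(rat \<Rightarrow>\<^sub>0 nat) \<Rightarrow>\<^sub>0 int"

definition zvar :: "rat \<Rightarrow> zpoly" where
  "zvar b = Poly_Mapping.single (Poly_Mapping.single b 1) 1"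

definition zpolys_in :: "rat set \<Rightarrow> zpoly set" where
  "zpolys_in S = {f. \<forall>\<mu>\<in>Poly_Mapping.keys f. Poly_Mapping.keys \<mu> \<subseteq> S}"

text \<open>The monomial of a weight with nonnegative coefficients; \<open>nat\<close> only changes the type of
  the exponents, because weights of words are nonnegative.\<close>

definition zmonom :: "weight \<Rightarrow> zpoly" where
  "zmonom \<mu> = (\<Prod>b\<in>Poly_Mapping.keys \<mu>. zvar b ^ nat (Poly_Mapping.lookup \<mu> b))"

definition ch :: "rat list set \<Rightarrow> zpoly" where
  "ch C = (\<Sum>w\<in>C. zmonom (wt w))"

definition zscale :: "int \<Rightarrow> zpoly \<Rightarrow> zpoly" where
  "zscale k p = of_int k * p"

interpretation zscale: module zscale
  by standard (simp_all add: zscale_def algebra_simps)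

definition char_span :: "nat \<Rightarrow> rat \<Rightarrow> zpoly set" where
  "char_span m n = zscale.span {ch (component m n w) | w. w \<in> words m n}"

definition zsubst :: "(rat \<Rightarrow> 'a::comm_ring_1) \<Rightarrow> zpoly \<Rightarrow> 'a" where
  "zsubst g f =
     (\<Sum>\<mu>\<in>Poly_Mapping.keys f. of_int (Poly_Mapping.lookup f \<mu>) *
        (\<Prod>b\<in>Poly_Mapping.keys \<mu>. g b ^ Poly_Mapping.lookup \<mu> b))"

definition symmetric_in :: "rat set \<Rightarrow> zpoly \<Rightarrow> bool" where
  "symmetric_in A f = (\<forall>\<sigma>. \<sigma> permutes A \<longrightarrow> zsubst (\<lambda>b. zvar (\<sigma> b)) f = f)"

text \<open>The result of \<open>z\<^sub>r = t\<close>, \<open>z\<^sub>s = -t\<close> is a univariate polynomial in \<open>t\<close> whose coefficients are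
  polynomials in the remaining variables; it is independent of \<open>t\<close> iff its degree (which is \<open>0\<close> for the
  zero polynomial) is \<open>0\<close>.\<close>

definition specialize :: "rat \<Rightarrow> rat \<Rightarrow> zpoly \<Rightarrow> zpoly poly" where
  "specialize r s =
     zsubst (\<lambda>b. if b = r then [:0, 1:] else if b = s then - [:0, 1:] else [:zvar b:])"

definition independent_of_t :: "zpoly poly \<Rightarrow> bool" where
  "independent_of_t p \<longleftrightarrow> degree p = 0"



lemma lookup_eps: "Poly_Mapping.lookup (\<epsilon> a) b = (if a = b then 1 else 0)"
  by (simp add: \<epsilon>_def lookup_single when_def)

lemma eps_eq_iff [simp]: "\<epsilon> a = \<epsilon> b \<longleftrightarrow> a = b"
proof
  assume "\<epsilon> a = \<epsilon> b"
  then have "Poly_Mapping.lookup (\<epsilon> a) a = Poly_Mapping.lookup (\<epsilon> b) a" by simp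
  then show "a = b" by (simp add: lookup_eps split: if_splits)
qed simp

lemma eps_diff_eq:
  assumes "a \<noteq> a'"
  shows "\<epsilon> a - \<epsilon> a' = \<epsilon> b - \<epsilon> b' \<longleftrightarrow> a = b \<and> a' = b'"
proof
  assume h: "\<epsilon> a - \<epsilon> a' = \<epsilon> b - \<epsilon> b'"
  have l: "Poly_Mapping.lookup (\<epsilon> a - \<epsilon> a') x = Poly_Mapping.lookup (\<epsilon> b - \<epsilon> b') x" for x
    by (simp add: h)
  show "a = b \<and> a' = b'"
    using l[of a] l[of a'] assms by (auto simp: lookup_minus lookup_eps split: if_splits)
qed simp

lemma simple_root_eq: "\<exists>a a'. a \<noteq> a' \<and> simple_root i = \<epsilon> a - \<epsilon> a'"
proof -
  consider "i < 0" | "i = 0" | "i > 0" by linarith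
  then show ?thesis
  proof cases
    case 1
    then show ?thesis by (intro exI[of _ "i-1"] exI[of _ i]) (simp add: simple_root_def)
  next
    case 2
    then show ?thesis by (intro exI[of _ "-1"] exI[of _ "1/2"]) (simp add: simple_root_def)
  next
    case 3
    then show ?thesis by (intro exI[of _ i] exI[of _ "i+1/2"]) (simp add: simple_root_def)
  qed
qed

lemma f_letter_iff: "f_letter i b = Some b' \<longleftrightarrow> simple_root i = \<epsilon> b - \<epsilon> b'"
proof -
  obtain a a' where a: "a \<noteq> a'" "simple_root i = \<epsilon> a - \<epsilon> a'" using simple_root_eq by blast
  show ?thesis by (auto simp: f_letter_def a(2) eps_diff_eq[OF a(1)])
qed

lemma e_letter_iff: "e_letter i b' = Some b \<longleftrightarrow> simple_root i = \<epsilon> b - \<epsilon> b'"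
proof -
  obtain a a' where a: "a \<noteq> a'" "simple_root i = \<epsilon> a - \<epsilon> a'" using simple_root_eq by blast
  show ?thesis by (auto simp: e_letter_def a(2) eps_diff_eq[OF a(1)])
qed

lemma pairing_add: "pairing a (b + c) = pairing a b + pairing a c"
  by (simp add: pairing_def lookup_add algebra_simps sum.distrib)

lemma pairing_root:
  assumes "a \<noteq> a'"
  shows "pairing (\<epsilon> a - \<epsilon> a') (\<epsilon> b) =
    (if b = a then parity_sign a else 0) - (if b = a' then parity_sign a' else 0)"
proof -
  have k: "Poly_Mapping.keys (\<epsilon> a - \<epsilon> a') = {a, a'}"
    using assms by (auto simp: in_keys_iff lookup_minus lookup_eps split: if_splits)
  show ?thesis using assms by (auto simp: pairing_def k lookup_minus lookup_eps)
qed

lemma wt_Nil [simp]: "wt [] = 0" by (simp add: wt_def)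
lemma wt_Cons: "wt (b # w) = wt [b] + wt w" by (simp add: wt_def)
lemma wt_append: "wt (u @ v) = wt u + wt v" by (simp add: wt_def)

lemma letter_phi:
  assumes "i \<in> simple_indices m n" "i < 0"
  shows "phi_letter i b = eps_letter i b + pairing (simple_root i) (wt [b])"
proof -
  have i: "i \<in> \<int>" using assms by (auto simp: simple_indices_def)
  have r: "simple_root i = \<epsilon> (i-1) - \<epsilon> i" using assms by (simp add: simple_root_def)
  have f: "f_letter i b \<noteq> None \<longleftrightarrow> b = i - 1"
    using f_letter_iff[of i b] eps_diff_eq[of "i-1" i b] unfolding r by auto
  have e: "e_letter i b \<noteq> None \<longleftrightarrow> b = i"
    using e_letter_iff[of i b] eps_diff_eq[of "i-1" i _ b] unfolding r by auto
  show ?thesis using i unfolding phi_letter_def eps_letter_def f e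
    by (simp add: r pairing_root wt_def parity_sign_def)
qed

lemma phi_eps:
  assumes "i \<in> simple_indices m n" "i < 0"
  shows "phi_word i w = eps_word i w + pairing (simple_root i) (wt w)"
proof (cases "w = []")
  case True then show ?thesis by (simp add: pairing_def)
next
  case False
  then show ?thesis
  proof (induction w rule: list_nonempty_induct)
    case (single b)
    show ?case using letter_phi[OF assms] by simp
  next
    case (cons b w)
    then obtain c w' where w: "w = c # w'" by (cases w) auto
    show ?case using cons(2) letter_phi[OF assms, of b] assms(2)
      by (auto simp: w wt_Cons[of b "c # w'"] pairing_add Let_def max_def)
  qed
qed

lemma eps_word_append_neg:
  assumes "i < 0" "u \<noteq> []" "v \<noteq> []"
  shows "eps_word i (u @ v) = max (eps_word i u) (eps_word i v - pairing (simple_root i) (wt u))"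
  using assms(2)
proof (induction u rule: list_nonempty_induct)
  case (single b)
  obtain c w where "v = c # w" using assms by (cases v) auto
  then show ?case using assms(1) by (simp add: Let_def)
next
  case (cons b u)
  then obtain c w where u: "u = c # w" by (cases u) auto
  show ?case using cons(2) assms(1)
    by (auto simp: u wt_Cons[of b "c # w"] pairing_add Let_def max_def)
qed

lemma phi_word_append_neg:
  assumes "i < 0" "u \<noteq> []" "v \<noteq> []"
  shows "phi_word i (u @ v) = max (phi_word i u + pairing (simple_root i) (wt v)) (phi_word i v)"
  using assms(2)
proof (induction u rule: list_nonempty_induct)
  case (single b)
  obtain c w where "v = c # w" using assms by (cases v) auto
  then show ?case using assms(1) by (simp add: Let_def)
next
  case (cons b u)
  then obtain c w where u: "u = c # w" by (cases u) auto
  show ?case using cons(2) assms(1)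
    by (auto simp: u wt_Cons[of b "c # w"] wt_append[of "c # w" v, simplified] pairing_add Let_def max_def)
qed

lemma pairing_wt_sign:
  assumes "i \<in> simple_indices m n" "\<not> i < 0"
  shows "if i \<in> \<int> then pairing (simple_root i) (wt w) \<ge> 0 else pairing (simple_root i) (wt w) \<le> 0"
proof -
  have h: "(1/2::rat) \<notin> \<int>"
  proof
    assume "(1/2::rat) \<in> \<int>"
    then obtain k where "(1/2::rat) = of_int k" by (rule Ints_cases)
    then have "(of_int (2 * k) :: rat) = of_int 1" by simp
    then have "2 * k = 1" unfolding of_int_eq_iff .
    then show False by presburger
  qed
  have letter: "if i \<in> \<int> then pairing (simple_root i) (\<epsilon> b) \<ge> 0 else pairing (simple_root i) (\<epsilon> b) \<le> 0" for b
  proof (cases "i = 0")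
    case True
    then have "simple_root i = \<epsilon> (-1) - \<epsilon> (1/2)" by (simp add: simple_root_def)
    then show ?thesis using h by (simp add: True pairing_root parity_sign_def)
  next
    case False
    then have r: "simple_root i = \<epsilon> i - \<epsilon> (i+1/2)" using assms by (simp add: simple_root_def)
    have i2: "2 * i \<in> \<int>" using assms False by (auto simp: simple_indices_def)
    have "i \<in> \<int> \<Longrightarrow> i + 1/2 \<notin> \<int>" using h Ints_diff[of "i+1/2" i] by auto
    moreover have "i \<notin> \<int> \<Longrightarrow> i + 1/2 \<in> \<int>"
    proof -
      assume ni: "i \<notin> \<int>"
      from i2 obtain k where k: "2 * i = of_int k" by (rule Ints_cases)
      have "odd k"
      proof
        assume "even k"
        then obtain j where "k = 2 * j" by (rule evenE)
        with k have "i = of_int j" by simp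
        with ni show False by simp
      qed
      then obtain j where "k = 2 * j + 1" by (rule oddE)
      with k have "i + 1/2 = of_int (j + 1)" by simp
      then show ?thesis using Ints_of_int by metis
    qed
    ultimately show ?thesis by (simp add: r pairing_root parity_sign_def)
  qed
  show ?thesis
  proof (induction w)
    case Nil show ?case by (simp add: pairing_def)
  next
    case (Cons b w)
    show ?case using Cons letter[of b] by (auto simp: wt_Cons[of b w] pairing_add wt_def split: if_splits)
  qed
qed

lemma acts_left_add:
  assumes "i \<in> simple_indices m n" "\<not> i < 0"
  shows acts_left_fst: "acts_left i (wt u + wt v) \<nu> \<longleftrightarrow>
      (if i \<in> \<int> then acts_left i (wt u) \<nu> \<or> acts_left i (wt v) \<nu> else acts_left i (wt v) \<nu>)"
    and acts_left_snd: "acts_left i \<mu> (wt u + wt v) \<longleftrightarrow>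
      (if i \<in> \<int> then acts_left i \<mu> (wt v) else acts_left i \<mu> (wt u) \<and> acts_left i \<mu> (wt v))"
  using pairing_wt_sign[OF assms, of u] pairing_wt_sign[OF assms, of v]
  by (auto simp: acts_left_def pairing_add split: if_splits)

lemma acts_left_indep:
  shows "i \<in> \<int> \<Longrightarrow> acts_left i \<mu> \<nu> = acts_left i \<mu> 0"
    and "i \<notin> \<int> \<Longrightarrow> acts_left i \<mu> \<nu> = acts_left i 0 \<nu>"
  by (auto simp: acts_left_def)

text \<open>The rule for the tensor product of two arbitrary nonempty words.\<close>

lemma ef_word_append:
  assumes i: "i \<in> simple_indices m n" and "u \<noteq> []" "v \<noteq> []"
  shows f_word_append: "f_word i (u @ v) =
      (if (if i < 0 then phi_word i u > eps_word i v else acts_left i (wt u) (wt v))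
       then map_option (\<lambda>u'. u' @ v) (f_word i u)
       else map_option (\<lambda>v'. u @ v') (f_word i v))"
    and e_word_append: "e_word i (u @ v) =
      (if (if i < 0 then phi_word i u \<ge> eps_word i v else acts_left i (wt u) (wt v))
       then map_option (\<lambda>u'. u' @ v) (e_word i u)
       else map_option (\<lambda>v'. u @ v') (e_word i v))"
    and "\<not> i < 0 \<Longrightarrow> eps_word i (u @ v) = (if acts_left i (wt u) (wt v) then eps_word i u else eps_word i v)"
    and "\<not> i < 0 \<Longrightarrow> phi_word i (u @ v) = (if acts_left i (wt u) (wt v) then phi_word i u else phi_word i v)"
proof -
  have "f_word i (u @ v) =
      (if (if i < 0 then phi_word i u > eps_word i v else acts_left i (wt u) (wt v))
       then map_option (\<lambda>u'. u' @ v) (f_word i u)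
       else map_option (\<lambda>v'. u @ v') (f_word i v)) \<and> e_word i (u @ v) =
      (if (if i < 0 then phi_word i u \<ge> eps_word i v else acts_left i (wt u) (wt v))
       then map_option (\<lambda>u'. u' @ v) (e_word i u)
       else map_option (\<lambda>v'. u @ v') (e_word i v))
     \<and> (\<not> i < 0 \<longrightarrow> eps_word i (u @ v) = (if acts_left i (wt u) (wt v) then eps_word i u else eps_word i v))
    \<and> (\<not> i < 0 \<longrightarrow> phi_word i (u @ v) = (if acts_left i (wt u) (wt v) then phi_word i u else phi_word i v))"
    using assms(2)
  proof (induction u rule: list_nonempty_induct)
    case (single b)
    obtain c w where "v = c # w" using assms by (cases v) auto
    moreover have "(@) [b] = (#) b" by auto
    ultimately show ?case by (simp add: Let_def option.map_comp comp_def)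
  next
    case (cons b u)
    then obtain c w where u: "u = c # w" by (cases u) auto
    have wt1: "wt (b # c # w) = wt [b] + wt (c # w)" by (rule wt_Cons)
    have wt2: "wt (c # w @ v) = wt (c # w) + wt v" using wt_append[of "c # w" v] by simp
    have app: "(\<lambda>x. b # c # w @ x) = (@) (b # c # w)" by auto
    show ?case
    proof (cases "i < 0")
      case True
      have e: "eps_word i (c # w @ v) = max (eps_word i u) (eps_word i v - pairing (simple_root i) (wt u))"
        using eps_word_append_neg[OF True, of u v] assms u by simp
      have p: "phi_word i u = eps_word i u + pairing (simple_root i) (wt u)"
        using phi_eps[OF i True] .
      have pb: "phi_word i (b # u) = max (phi_letter i b + pairing (simple_root i) (wt u)) (phi_word i u)"
        using True u by (simp add: Let_def)
      have a1: "phi_letter i b > eps_word i (c # w @ v) \<longleftrightarrow>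
         phi_letter i b > eps_word i u \<and> phi_word i (b # u) > eps_word i v"
        and a2: "\<not> phi_letter i b > eps_word i (c # w @ v) \<Longrightarrow>
         phi_word i u > eps_word i v \<longleftrightarrow> phi_word i (b # u) > eps_word i v"
        and a3: "phi_letter i b \<ge> eps_word i (c # w @ v) \<longleftrightarrow>
         phi_letter i b \<ge> eps_word i u \<and> phi_word i (b # u) \<ge> eps_word i v"
        and a4: "\<not> phi_letter i b \<ge> eps_word i (c # w @ v) \<Longrightarrow>
         phi_word i u \<ge> eps_word i v \<longleftrightarrow> phi_word i (b # u) \<ge> eps_word i v"
        using p unfolding e pb by linarith+
      show ?thesis
        using cons(2) True a1 a2 a3 a4
        by (auto simp: u app Let_def option.map_comp comp_def simp del: phi_word.simps eps_word.simps)
    next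
      case False
      show ?thesis
        using cons(2) False acts_left_fst[OF i False, of "[b]" "c # w" "wt v"]
          acts_left_snd[OF i False, of "wt [b]" "c # w" v]
          acts_left_indep(1)[of i "wt [b]" "wt v"] acts_left_indep(1)[of i "wt [b]" "wt (c # w)"]
          acts_left_indep(2)[of i "wt [b]" "wt v"] acts_left_indep(2)[of i "wt (c # w)" "wt v"]
        by (cases "i \<in> \<int>") (auto simp: u app Let_def option.map_comp comp_def wt1 wt2)
    qed
  qed
  then show "f_word i (u @ v) =
      (if (if i < 0 then phi_word i u > eps_word i v else acts_left i (wt u) (wt v))
       then map_option (\<lambda>u'. u' @ v) (f_word i u)
       else map_option (\<lambda>v'. u @ v') (f_word i v))" and "e_word i (u @ v) =
      (if (if i < 0 then phi_word i u \<ge> eps_word i v else acts_left i (wt u) (wt v))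
       then map_option (\<lambda>u'. u' @ v) (e_word i u)
       else map_option (\<lambda>v'. u @ v') (e_word i v))"
     "(\<not> i < 0 \<Longrightarrow> eps_word i (u @ v) = (if acts_left i (wt u) (wt v) then eps_word i u else eps_word i v))"
    "(\<not> i < 0 \<Longrightarrow> phi_word i (u @ v) = (if acts_left i (wt u) (wt v) then phi_word i u else phi_word i v))"
    by blast+
qed

text \<open>Components are finite, so \<open>ch\<close> of a component is a genuine finite sum.\<close>

lemma finite_letters_upto: "finite (letters_upto m n)"
proof (rule finite_subset)
  show "letters_upto m n \<subseteq> (\<lambda>k. of_int k / 2) ` {- 2 * int m .. \<lfloor>2 * n\<rfloor>}"
  proof
    fix b assume b: "b \<in> letters_upto m n"
    then have "2 * b \<in> \<int>" by (auto simp: letters_upto_def letters_def)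
    then obtain k where k: "2 * b = of_int k" by (rule Ints_cases)
    have "- of_nat m \<le> b" "b \<le> n" using b
      by (auto simp: letters_upto_def letters_def intro: order_trans[of _ 0])
    then have "of_int (- 2 * int m) \<le> (of_int k :: rat)" "of_int k \<le> 2 * n" using k by simp_all
    then have "k \<in> {- 2 * int m .. \<lfloor>2 * n\<rfloor>}" unfolding of_int_le_iff by (simp add: le_floor_iff)
    moreover have "b = of_int k / 2" using k by simp
    ultimately show "b \<in> (\<lambda>k. of_int k / 2) ` {- 2 * int m .. \<lfloor>2 * n\<rfloor>}" by blast
  qed
qed simp

lemma length_f_word: "f_word i w = Some w' \<Longrightarrow> length w' = length w"
  by (induction i w arbitrary: w' rule: f_word.induct) (auto simp: Let_def split: if_splits)

lemma finite_component:
  assumes "w \<in> words m n"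
  shows "finite (component m n w)"
proof (rule finite_subset)
  show "component m n w \<subseteq> {w'. set w' \<subseteq> letters_upto m n \<and> length w' = length w}"
  proof
    fix w' assume "w' \<in> component m n w"
    then have "(w, w') \<in> (crystal_edges m n \<union> (crystal_edges m n)\<inverse>)\<^sup>*" by (simp add: component_def)
    then have "w' \<in> words m n \<and> length w' = length w"
      by (induction rule: rtrancl_induct) (auto simp: assms crystal_edges_def dest: length_f_word)
    then show "w' \<in> {w'. set w' \<subseteq> letters_upto m n \<and> length w' = length w}" by (auto simp: words_def)
  qed
qed (simp add: finite_lists_length_eq finite_letters_upto)

end

theory Submission
  imports Defs
begin

text \<open>
  For an index \<open>i \<ge> 0\<close> the operator \<open>f\<^sub>i\<close> toggles the first (\<open>i\<close> integral) or last letter of a word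
  among the two letters of \<open>\<alpha>\<^sub>i\<close>.  So every component is matched up by words whose contributions to
  the specialization \<open>z\<^sub>r = -z\<^sub>s = t\<close> cancel, while for \<open>i < 0\<close> the \<open>i\<close>-strings make characters symmetric.

  Conversely, order exponents lexicographically with the smallest letter first.  The leading exponent of
  a polynomial satisfying both conditions decreases on the negative letters, and its support is closed
  under passing from \<open>s\<close> to \<open>r\<close>.  Each such exponent is the unique leading weight, with multiplicity one,
  of a set of words closed under all crystal operators: concatenations of closed sets are closed, so it
  is enough to treat exponents at most 1 on negative letters.  For these take a word \<open>w\<close> killed by all
  \<open>e\<^sub>i\<close>, and all words with the same pattern of (super) inversions as \<open>w\<close>; then \<open>w\<close> is the letterwise
  minimum of this set.  Subtracting multiples of characters of closed sets terminates.
\<close>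

subsection \<open>Letters and exponents\<close>

text \<open>Individual components are hard to describe, but the subtraction only needs sets closed
  under the operators: such a set is a disjoint union of components, so its character lies in the
  span. The relation \<open>column_pair\<close> is built to survive every operator. No letter lies
  between the two letters of a simple root, so turning one into the other cannot affect its relation
  to a third letter; only other copies of these two letters matter. For i \<ge> 0 the two have
  opposite parity, and counting equal odd letters, but not equal even ones, as a column pair makes
  the relation of the first (or last) copy to the rest insensitive to the change. For i < 0 both
  letters are even and repetitions do harm: the operator of index -1 takes -2 -1 -2 to -2 -1 -1, and
  the outer letters become a column pair. Hence a pattern may use each negative letter at most once,
  and larger exponents are assembled by concatenation, one column at a time.\<close>

definition lower_letter :: "rat \<Rightarrow> rat" where
  "lower_letter i = (if i < 0 then i - 1 else if i = 0 then -1 else i)"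

definition upper_letter :: "rat \<Rightarrow> rat" where
  "upper_letter i = (if i < 0 then i else if i = 0 then 1/2 else i + 1/2)"

lemma simple_root_letters: "simple_root i = \<epsilon> (lower_letter i) - \<epsilon> (upper_letter i)"
  by (simp add: simple_root_def lower_letter_def upper_letter_def)

lemma lower_less_upper: "lower_letter i < upper_letter i"
  by (simp add: lower_letter_def upper_letter_def)

lemma f_letter_eq: "f_letter i b = (if b = lower_letter i then Some (upper_letter i) else None)"
proof -
  have "f_letter i b = Some b' \<longleftrightarrow> b = lower_letter i \<and> b' = upper_letter i" for b'
    using lower_less_upper[of i]
    by (auto simp: f_letter_iff simple_root_letters eps_diff_eq)
  then show ?thesis by (cases "f_letter i b") auto
qed

lemma e_letter_eq: "e_letter i b = (if b = upper_letter i then Some (lower_letter i) else None)"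
proof -
  have "e_letter i b = Some b' \<longleftrightarrow> b = upper_letter i \<and> b' = lower_letter i" for b'
    using lower_less_upper[of i]
    by (auto simp: e_letter_iff simple_root_letters eps_diff_eq)
  then show ?thesis by (cases "e_letter i b") auto
qed

lemma half_not_int: "(1/2::rat) \<notin> \<int>"
proof
  assume "(1/2::rat) \<in> \<int>"
  then obtain k where "(1/2::rat) = of_int k" by (rule Ints_cases)
  then have "(of_int (2 * k) :: rat) = of_int 1" by simp
  then have "2 * k = 1" unfolding of_int_eq_iff .
  then show False by presburger
qed

lemma int_add_half_iff:
  assumes "2 * (b::rat) \<in> \<int>"
  shows "b + 1/2 \<in> \<int> \<longleftrightarrow> b \<notin> \<int>"
proof -
  obtain k where k: "2 * b = of_int k" using assms by (rule Ints_cases)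
  show ?thesis
  proof (cases "even k")
    case True
    then obtain j where "k = 2 * j" by (rule evenE)
    with k have b: "b = of_int j" by simp
    then have "b + 1/2 \<notin> \<int>"
      using half_not_int Ints_diff[of "b + 1/2" b] by auto
    then show ?thesis using b by simp
  next
    case False
    then obtain j where "k = 2 * j + 1" by (rule oddE)
    with k have b: "b = of_int j + 1/2" by simp
    then have "b \<notin> \<int>"
      using half_not_int Ints_diff[of b "of_int j"] by auto
    moreover have "b + 1/2 = of_int (j + 1)" using b by simp
    then have "b + 1/2 \<in> \<int>" by (metis Ints_of_int)
    ultimately show ?thesis by simp
  qed
qed

lemma index_letters:
  assumes "i \<in> simple_indices m n" and "0 < n" and "2 * n \<in> \<int>"
  shows "lower_letter i \<in> letters_upto m n" "upper_letter i \<in> letters_upto m n"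
proof -
  \<comment> \<open>Index 0 involves the letter 1/2 whatever n is; a positive half-integer n is
    large enough for it.\<close>
  have n: "1/2 \<le> n"
  proof -
    obtain k where k: "2 * n = of_int k" using assms(3) by (rule Ints_cases)
    then have "0 < (of_int k :: rat)" using assms(2) by simp
    then have "1 \<le> k" by simp
    then have "(1::rat) \<le> of_int k" by simp
    then show ?thesis using k by simp
  qed
  have d: "2 * (i + 1/2) \<in> \<int>" if "2 * i \<in> \<int>"
  proof -
    have "2 * (i + 1/2) = 2 * i + 1" by simp
    then show ?thesis using that Ints_add[of "2*i" 1] by simp
  qed
  consider "i \<in> \<int>" "- of_nat m + 1 \<le> i" "i \<le> -1" | "i = 0" "1 \<le> m"
    | "2 * i \<in> \<int>" "0 < i" "i + 1/2 \<le> n"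
    using assms(1) unfolding simple_indices_def by blast
  then have "lower_letter i \<in> letters_upto m n \<and> upper_letter i \<in> letters_upto m n"
  proof cases
    case 1
    then show ?thesis using n
      by (auto simp: lower_letter_def upper_letter_def letters_upto_def letters_def)
  next
    case 2
    then show ?thesis using n
      by (auto simp: lower_letter_def upper_letter_def letters_upto_def letters_def)
  next
    case 3
    then show ?thesis using n d
      by (auto simp: lower_letter_def upper_letter_def letters_upto_def letters_def)
  qed
  then show "lower_letter i \<in> letters_upto m n" "upper_letter i \<in> letters_upto m n" by auto
qed

lemma half_integer_gap:
  assumes "2 * (b::rat) \<in> \<int>" "2 * c \<in> \<int>" "b < c"
  shows "b + 1/2 \<le> c"
proof -
  obtain k l where k: "2 * b = of_int k" "2 * c = of_int l"
    using assms(1,2) by (metis Ints_cases)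
  have "(of_int k :: rat) < of_int l" using k assms(3) by linarith
  then have "k + 1 \<le> l" by simp
  then have "(of_int (k + 1) :: rat) \<le> of_int l" by (simp only: of_int_le_iff)
  then show ?thesis using k by simp
qed

lemma integer_gap:
  assumes "(b::rat) \<in> \<int>" "c \<in> \<int>" "b < c"
  shows "b + 1 \<le> c"
proof -
  obtain k l where k: "b = of_int k" "c = of_int l"
    using assms(1,2) by (metis Ints_cases)
  then have "k + 1 \<le> l" using assms(3) by simp
  then have "(of_int (k + 1) :: rat) \<le> of_int l" by (simp only: of_int_le_iff)
  then show ?thesis using k by simp
qed

lemma letter_cases:
  assumes "b \<in> letters_upto m n"
  obtains "b \<in> \<int>" "- of_nat m \<le> b" "b \<le> -1" "b < 0" | "2 * b \<in> \<int>" "0 < b" "1/2 \<le> b"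
  using assms half_integer_gap[of 0 b] by (auto simp: letters_upto_def letters_def)

text \<open>The two letters of a simple root are neighbours in the alphabet. This discreteness
  drives both the minimality of source words and the stability of
  \<open>column_pair\<close>.\<close>

lemma letter_ge_upper:
  assumes "i \<in> simple_indices m n" and "b \<in> letters_upto m n" and "lower_letter i < b"
  shows "upper_letter i \<le> b"
proof -
  consider "i \<in> \<int>" "i \<le> -1" | "i = 0" | "2 * i \<in> \<int>" "0 < i"
    using assms(1) unfolding simple_indices_def by blast
  then show ?thesis
  proof cases
    case 1
    then show ?thesis using assms(3) integer_gap[of "i - 1" b]
      by (cases rule: letter_cases[OF assms(2)]) (auto simp: lower_letter_def upper_letter_def)
  next
    case 2
    then show ?thesis using assms(3)
      by (cases rule: letter_cases[OF assms(2)]) (auto simp: lower_letter_def upper_letter_def)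
  next
    case 3
    then show ?thesis using assms(3) half_integer_gap[of i b]
      by (cases rule: letter_cases[OF assms(2)]) (auto simp: lower_letter_def upper_letter_def)
  qed
qed

text \<open>The simple roots link the alphabet into a single chain, so every letter except the least
  is the upper end of a link. For the letter 1/2, a smaller letter can only be negative; this forces
  m \<ge> 1 and makes index 0 available.\<close>

lemma predecessor_index:
  assumes "c \<in> letters_upto m n" and "b \<in> letters_upto m n" and "b < c"
  obtains i where "i \<in> simple_indices m n" "upper_letter i = c"
proof (cases rule: letter_cases[OF assms(1)])
  case 1
  then have b: "b \<in> \<int>" "- of_nat m \<le> b" "b < 0"
    using assms(3) by (cases rule: letter_cases[OF assms(2)]; simp)+
  then have "b + 1 \<le> c" using integer_gap 1 assms(3) by blast
  then show ?thesis using 1 b by (intro that[of c]) (auto simp: simple_indices_def upper_letter_def)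
next
  case 2
  show ?thesis
  proof (cases "c = 1/2")
    case True
    then have "of_nat m \<ge> (1::rat)"
      using assms(3) by (cases rule: letter_cases[OF assms(2)]) auto
    then show ?thesis using True
      by (intro that[of 0]) (auto simp: simple_indices_def upper_letter_def)
  next
    case False
    have "2 * (c - 1/2) = 2 * c - 1" by simp
    then have "2 * (c - 1/2) \<in> \<int>" using 2 Ints_diff[of "2*c" 1] by simp
    moreover have "c - 1/2 > 0" using 2 False by simp
    moreover have "c \<le> n" using assms(1) by (simp add: letters_upto_def)
    ultimately show ?thesis
      by (intro that[of "c - 1/2"]) (auto simp: simple_indices_def upper_letter_def)
  qed
qed

text \<open>Roots of negative index join two even letters; all others join letters of opposite
  parity and are isotropic.\<close>

lemma letter_parity:
  assumes "i \<in> simple_indices m n"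
  shows "i < 0 \<Longrightarrow> lower_letter i \<in> \<int>" "i < 0 \<Longrightarrow> upper_letter i \<in> \<int>"
    "0 \<le> i \<Longrightarrow> lower_letter i \<in> \<int> \<longleftrightarrow> i \<in> \<int>" "0 \<le> i \<Longrightarrow> upper_letter i \<in> \<int> \<longleftrightarrow> i \<notin> \<int>"
  using assms half_not_int int_add_half_iff[of i]
  by (auto simp: simple_indices_def lower_letter_def upper_letter_def)

section \<open>Exponents of words, coefficients of characters, substitution\<close>

definition expo :: "rat list \<Rightarrow> rat \<Rightarrow>\<^sub>0 nat" where
  "expo w = (\<Sum>b\<leftarrow>w. Poly_Mapping.single b 1)"

lemma expo_simps [simp]:
  "expo [] = 0"
  "expo (b # w) = Poly_Mapping.single b 1 + expo w"
  "expo (u @ v) = expo u + expo v"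
  by (simp_all add: expo_def)

lemma lookup_expo: "Poly_Mapping.lookup (expo w) b = count_list w b"
  by (induction w) (auto simp: lookup_add lookup_single when_def)

lemma lookup_wt: "Poly_Mapping.lookup (wt w) b = int (count_list w b)"
  by (induction w) (auto simp: wt_def lookup_add lookup_eps)

lemma keys_expo: "Poly_Mapping.keys (expo w) = set w"
  by (auto simp: in_keys_iff lookup_expo count_list_0_iff)

lemma keys_wt: "Poly_Mapping.keys (wt w) = set w"
  by (auto simp: in_keys_iff lookup_wt count_list_0_iff)

lemma expo_eq_imp_length:
  assumes "expo u = expo v"
  shows "length u = length v"
proof -
  have "count_list u = count_list v" using assms by (metis ext lookup_expo)
  then have "mset u = mset v" by (metis count_mset multiset_eqI)
  then show ?thesis by (rule mset_eq_length)
qed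

lemma ex_word_expo:
  assumes "Poly_Mapping.keys \<mu> \<subseteq> S"
  shows "\<exists>w \<in> lists S. expo w = \<mu>"
proof -
  obtain M where M: "set_mset M = Poly_Mapping.keys \<mu>" "\<And>b. count M b = Poly_Mapping.lookup \<mu> b"
  proof
    have fin: "finite {b. Poly_Mapping.lookup \<mu> b > 0}" by simp
    show c: "count (Abs_multiset (Poly_Mapping.lookup \<mu>)) b = Poly_Mapping.lookup \<mu> b" for b
      using Abs_multiset_inverse[of "Poly_Mapping.lookup \<mu>"] fin by simp
    show "set_mset (Abs_multiset (Poly_Mapping.lookup \<mu>)) = Poly_Mapping.keys \<mu>"
      unfolding set_mset_def c by (auto simp: in_keys_iff)
  qed
  obtain w where w: "mset w = M" using ex_mset by blast
  then have "count_list w b = Poly_Mapping.lookup \<mu> b" for b using M(2) count_mset by metis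
  then have "expo w = \<mu>" by (intro poly_mapping_eqI) (simp add: lookup_expo)
  moreover have "set w = Poly_Mapping.keys \<mu>" using w M(1) by (metis set_mset_mset)
  ultimately show ?thesis using assms by (intro bexI[of _ w]) auto
qed

lemma prod_zvar:
  "finite A \<Longrightarrow> (\<Prod>b\<in>A. zvar b ^ k b) = Poly_Mapping.single (\<Sum>b\<in>A. Poly_Mapping.single b (k b)) 1"
proof (induction rule: finite_induct)
  case (insert a A)
  have "zvar a ^ j = Poly_Mapping.single (Poly_Mapping.single a j) 1" for j
    by (induction j) (simp_all add: zvar_def mult_single single_add[symmetric])
  then show ?case using insert by (simp add: mult_single)
qed simp

lemma sum_single_lookup:
  "(\<Sum>b\<in>Poly_Mapping.keys \<mu>. Poly_Mapping.single b (Poly_Mapping.lookup \<mu> b)) = \<mu>"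
proof (rule poly_mapping_eqI)
  fix k
  show "Poly_Mapping.lookup (\<Sum>b\<in>Poly_Mapping.keys \<mu>. Poly_Mapping.single b (Poly_Mapping.lookup \<mu> b)) k
      = Poly_Mapping.lookup \<mu> k"
    by (auto simp: lookup_sum lookup_single when_def in_keys_iff)
qed

lemma zmonom_wt: "zmonom (wt w) = Poly_Mapping.single (expo w) 1"
proof -
  have "zmonom (wt w) = (\<Prod>b\<in>Poly_Mapping.keys (expo w). zvar b ^ Poly_Mapping.lookup (expo w) b)"
    by (simp add: zmonom_def keys_wt keys_expo lookup_wt lookup_expo)
  then show ?thesis by (simp add: prod_zvar sum_single_lookup)
qed

lemma lookup_ch:
  assumes "finite C"
  shows "Poly_Mapping.lookup (ch C) \<mu> = int (card {w \<in> C. expo w = \<mu>})"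
proof -
  have "Poly_Mapping.lookup (ch C) \<mu> = (\<Sum>w\<in>C. if expo w = \<mu> then 1 else 0)"
    by (simp add: ch_def zmonom_wt lookup_sum lookup_single when_def eq_commute[of \<mu>])
  also have "\<dots> = (\<Sum>w\<in>{w \<in> C. expo w = \<mu>}. 1)"
    using assms by (subst sum.inter_filter) simp_all
  finally show ?thesis by simp
qed

lemma zsubst_superset:
  assumes "finite K" "Poly_Mapping.keys f \<subseteq> K"
  shows "zsubst g f = (\<Sum>\<mu>\<in>K. of_int (Poly_Mapping.lookup f \<mu>) *
        (\<Prod>b\<in>Poly_Mapping.keys \<mu>. g b ^ Poly_Mapping.lookup \<mu> b))"
  unfolding zsubst_def
  by (rule sum.mono_neutral_left) (use assms in \<open>auto simp: in_keys_iff\<close>)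

lemma zsubst_zero [simp]: "zsubst g 0 = 0"
  by (simp add: zsubst_def)

lemma zsubst_add: "zsubst g (f + h) = zsubst g f + zsubst g h"
proof -
  let ?K = "Poly_Mapping.keys f \<union> Poly_Mapping.keys h"
  have "zsubst g (f + h) = (\<Sum>\<mu>\<in>?K. of_int (Poly_Mapping.lookup (f + h) \<mu>) *
        (\<Prod>b\<in>Poly_Mapping.keys \<mu>. g b ^ Poly_Mapping.lookup \<mu> b))"
    by (rule zsubst_superset) (use Poly_Mapping.keys_add[of f h] in auto)
  also have "\<dots> = zsubst g f + zsubst g h"
    by (simp add: zsubst_superset[of ?K f] zsubst_superset[of ?K h] lookup_add algebra_simps sum.distrib)
  finally show ?thesis .
qed

lemma lookup_zscale [simp]: "Poly_Mapping.lookup (zscale k f) \<mu> = k * Poly_Mapping.lookup f \<mu>"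
proof -
  have "zscale k f = Poly_Mapping.single 0 k * f"
    by (simp add: zscale_def flip: single_of_int)
  then have "zscale k f = Poly_Mapping.map ((*) k) f" by (simp add: mult_map_scale_conv_mult)
  then show ?thesis by (simp add: Poly_Mapping.map.rep_eq when_def)
qed

subsection \<open>Crystal operators on words\<close>

text \<open>The form has opposite signs on even and odd letters. Two even letters make the counts
  subtract; for opposite parities they add up, so no cancellation can hide an occurrence.\<close>

lemma pairing_root_wt:
  assumes "i \<in> simple_indices m n"
  shows "pairing (simple_root i) (wt w) =
    (if i < 0 then int (count_list w (lower_letter i)) - int (count_list w (upper_letter i))
     else parity_sign i * (int (count_list w (lower_letter i)) + int (count_list w (upper_letter i))))"
proof (induction w)
  case Nil
  show ?case by (simp add: pairing_def)
next
  case (Cons b w)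
  have "pairing (simple_root i) (wt [b]) =
    (if i < 0 then (if b = lower_letter i then 1 else 0) - (if b = upper_letter i then 1 else 0)
     else parity_sign i * ((if b = lower_letter i then 1 else 0) + (if b = upper_letter i then 1 else 0)))"
    using lower_less_upper[of i] letter_parity[OF assms]
    by (cases "i < 0") (auto simp: simple_root_letters wt_def pairing_root parity_sign_def)
  then show ?case
    using Cons by (auto simp: wt_Cons[of b w] pairing_add algebra_simps)
qed

text \<open>A sum of two counts vanishes only if both do, so the pairing tests whether a letter of
  the root occurs at all.\<close>

lemma acts_left_wt:
  assumes "i \<in> simple_indices m n" "0 \<le> i"
  shows "acts_left i (wt u) (wt v) \<longleftrightarrow>
    (if i \<in> \<int> then set u \<inter> {lower_letter i, upper_letter i} \<noteq> {}
     else set v \<inter> {lower_letter i, upper_letter i} = {})"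
proof -
  have *: "int a + int b = 0 \<longleftrightarrow> a = 0 \<and> b = 0" for a b by linarith
  show ?thesis using assms(2)
    by (auto simp: acts_left_def pairing_root_wt[OF assms(1)] parity_sign_def * count_list_0_iff)
qed

lemma f_word_Cons_nonneg:
  assumes "i \<in> simple_indices m n" "0 \<le> i"
  shows "f_word i (b # w) =
    (if (if i \<in> \<int> then b \<in> {lower_letter i, upper_letter i} else set w \<inter> {lower_letter i, upper_letter i} = {})
     then (if b = lower_letter i then Some (upper_letter i # w) else None)
     else map_option ((#) b) (f_word i w))"
proof (cases w)
  case (Cons c v)
  show ?thesis using assms(2) acts_left_wt[OF assms, of "[b]" w]
    by (auto simp: Cons Let_def f_letter_eq)
qed (auto simp: f_letter_eq)

text \<open>Every tensor step passes to the factor holding the first (i integral) or last letter of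
  the root. The recursion therefore ends at that letter, and is defined only if it is the lower
  one.\<close>

lemma f_word_nonneg_iff:
  assumes "i \<in> simple_indices m n" "0 \<le> i"
  shows "f_word i w = Some w' \<longleftrightarrow>
    (\<exists>u v. w = u @ lower_letter i # v \<and> w' = u @ upper_letter i # v \<and>
       (if i \<in> \<int> then set u else set v) \<inter> {lower_letter i, upper_letter i} = {})"
  (is "_ \<longleftrightarrow> ?R w w'")
proof (induction w arbitrary: w')
  case (Cons b w)
  have R: "?R (b # w) w' \<longleftrightarrow>
      (b = lower_letter i \<and> w' = upper_letter i # w \<and>
        (i \<notin> \<int> \<longrightarrow> set w \<inter> {lower_letter i, upper_letter i} = {})) \<or>
      (\<exists>w''. w' = b # w'' \<and> ?R w w'' \<and> (i \<in> \<int> \<longrightarrow> b \<notin> {lower_letter i, upper_letter i}))"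
    (is "_ \<longleftrightarrow> ?A \<or> ?B")
  proof
    assume "?R (b # w) w'"
    then obtain u v where uv: "b # w = u @ lower_letter i # v" "w' = u @ upper_letter i # v"
      "(if i \<in> \<int> then set u else set v) \<inter> {lower_letter i, upper_letter i} = {}" by blast
    then show "?A \<or> ?B" by (cases u) (auto split: if_splits)
  next
    assume "?A \<or> ?B"
    then show "?R (b # w) w'"
    proof
      assume ?A
      then show ?thesis by (intro exI[of _ "[]"] exI[of _ w]) auto
    next
      assume ?B
      then obtain u v where "w = u @ lower_letter i # v" "w' = b # u @ upper_letter i # v"
       "(if i \<in> \<int> then set u else set v) \<inter> {lower_letter i, upper_letter i} = {}"
       "i \<in> \<int> \<longrightarrow> b \<notin> {lower_letter i, upper_letter i}" by blast
      then show ?thesis by (intro exI[of _ "b # u"] exI[of _ v]) auto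
    qed
  qed
  \<comment> \<open>Being defined on the tail means that the tail holds a letter of the root; for
    half-integral i the rule then skips the head.\<close>
  have meets: "?R w w'' \<Longrightarrow> set w \<inter> {lower_letter i, upper_letter i} \<noteq> {}" for w'' by auto
  have meets': "set w \<inter> {lower_letter i, upper_letter i} \<noteq> {}" if "f_word i w = Some w''" for w''
    using meets[of w''] Cons[of w''] that by simp
  have "f_word i (b # w) = Some w' \<longleftrightarrow>
      (b = lower_letter i \<and> w' = upper_letter i # w \<and>
        (i \<notin> \<int> \<longrightarrow> set w \<inter> {lower_letter i, upper_letter i} = {})) \<or>
      (\<exists>w''. w' = b # w'' \<and> f_word i w = Some w'' \<and> (i \<in> \<int> \<longrightarrow> b \<notin> {lower_letter i, upper_letter i}))"
    unfolding f_word_Cons_nonneg[OF assms] using meets' by (cases "i \<in> \<int>") (auto simp del: f_word.simps)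
  then show ?case unfolding R Cons .
qed simp

section \<open>Operators of negative index as a bracketing rule\<close>

lemma eps_word_nonneg_value: "i < 0 \<Longrightarrow> 0 \<le> eps_word i w"
  by (induction i w rule: eps_word.induct) (auto simp: eps_letter_def Let_def)

text \<open>Read from the right, an upper letter opens a bracket and a lower letter closes one if
  any is open; \<open>eps_word\<close> counts the brackets left open. The maximum covers a lower
  letter with nothing to close.\<close>

lemma eps_word_Cons_neg:
  assumes "i \<in> simple_indices m n" "i < 0"
  shows "eps_word i (b # w) =
    (if b = upper_letter i then eps_word i w + 1
     else if b = lower_letter i then max 0 (eps_word i w - 1) else eps_word i w)"
proof (cases w)
  case (Cons c v)
  show ?thesis using assms(2) pairing_root_wt[OF assms(1), of "[b]"] lower_less_upper[of i]
      eps_word_nonneg_value[of i w]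
    by (auto simp: Cons Let_def eps_letter_def e_letter_eq)
qed (auto simp: eps_letter_def e_letter_eq)

text \<open>A lower letter is unpaired exactly when no bracket is open behind it, so the operator
  changes the leftmost unpaired lower letter.\<close>

lemma f_word_Cons_neg:
  assumes "i \<in> simple_indices m n" "i < 0"
  shows "f_word i (b # w) =
    (if b = lower_letter i \<and> eps_word i w = 0 then Some (upper_letter i # w)
     else map_option ((#) b) (f_word i w))"
proof (cases w)
  case (Cons c v)
  show ?thesis using assms(2) eps_word_nonneg_value[of i w]
    by (auto simp: Cons Let_def phi_letter_def f_letter_eq)
qed (auto simp: f_letter_eq)

lemma eps_f_word:
  assumes "i \<in> simple_indices m n" "i < 0" "f_word i w = Some w'"
  shows "eps_word i w' = eps_word i w + 1"
  using assms(3)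
proof (induction w arbitrary: w')
  case (Cons b w)
  then show ?case using lower_less_upper[of i] eps_word_nonneg_value[OF assms(2), of w]
    by (auto simp: f_word_Cons_neg[OF assms(1,2)] eps_word_Cons_neg[OF assms(1,2)] split: if_splits)
qed simp

text \<open>The tail of the image reveals where the operator acted: acting in the tail leaves its
  \<open>eps_word\<close> positive, acting on the head requires it to be 0.\<close>

lemma f_word_neg_inj:
  assumes "i \<in> simple_indices m n" "i < 0" "f_word i u = Some w" "f_word i v = Some w"
  shows "u = v"
  using assms(3,4)
proof (induction w arbitrary: u v)
  case Nil
  then show ?case by (auto dest!: length_f_word)
next
  case (Cons c w)
  obtain a x b y where uv: "u = a # x" "v = b # y"
    using Cons.prems by (cases u; cases v) auto
  have "eps_word i w \<noteq> 0" if "f_word i z = Some w" for z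
    using eps_f_word[OF assms(1,2) that] eps_word_nonneg_value[OF assms(2), of z] by linarith
  then show ?case
    using Cons lower_less_upper[of i]
    by (auto simp: uv f_word_Cons_neg[OF assms(1,2)] split: if_splits)
qed

lemma f_word_neg_surj:
  assumes "i \<in> simple_indices m n" "i < 0" "0 < eps_word i w"
  shows "\<exists>u. f_word i u = Some w"
  using assms(3)
proof (induction w)
  case (Cons b w)
  note rules = f_word_Cons_neg[OF assms(1,2)] eps_word_Cons_neg[OF assms(1,2)]
  show ?case
  proof (cases "eps_word i w = 0")
    case True
    with Cons.prems have "b = upper_letter i" by (auto simp: rules split: if_splits)
    then show ?thesis using True by (intro exI[of _ "lower_letter i # w"]) (simp add: rules)
  next
    case False
    then have pos: "0 < eps_word i w" using eps_word_nonneg_value[OF assms(2), of w] by linarith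
    then obtain u where u: "f_word i u = Some w" using Cons.IH by blast
    \<comment> \<open>Here at least two brackets are open in w, hence at least one in u, and the
      operator passes over the head.\<close>
    have "b = lower_letter i \<Longrightarrow> eps_word i u \<noteq> 0"
      using Cons.prems eps_f_word[OF assms(1,2) u] lower_less_upper[of i] by (auto simp: rules)
    then show ?thesis using u by (intro exI[of _ "b # u"]) (auto simp: rules)
  qed
qed simp

text \<open>The quantity \<open>eps + pairing\<close> is \<open>phi\<close>.\<close>

lemma f_word_neg_defined:
  assumes "i \<in> simple_indices m n" "i < 0"
    "0 < eps_word i w + int (count_list w (lower_letter i)) - int (count_list w (upper_letter i))"
  shows "f_word i w \<noteq> None"
  using assms(3)
proof (induction w)
  case (Cons b w)
  then show ?case using lower_less_upper[of i] eps_word_nonneg_value[OF assms(2), of w]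
    by (auto simp: f_word_Cons_neg[OF assms(1,2)] eps_word_Cons_neg[OF assms(1,2)] max_def split: if_splits)
qed simp

text \<open>Each upper letter is left open or is closed by a lower letter of its own. In other words
  \<open>phi\<close> is nonnegative.\<close>

lemma eps_word_lower_bound:
  assumes "i \<in> simple_indices m n" "i < 0"
  shows "int (count_list w (upper_letter i)) \<le> eps_word i w + int (count_list w (lower_letter i))"
proof (induction w)
  case (Cons b w)
  then show ?case using lower_less_upper[of i]
    by (auto simp: eps_word_Cons_neg[OF assms(1,2)])
qed simp

text \<open>To the right of the changed letter no bracket stays open; lower letters to its left are
  paired, with partners also on the left. If negative letters increase strictly before or after the
  change, these conditions leave no further copy of either letter of the root.\<close>

lemma f_word_neg_split:
  assumes "i \<in> simple_indices m n" "i < 0" "f_word i w = Some w'"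
  shows "\<exists>u v. w = u @ lower_letter i # v \<and> w' = u @ upper_letter i # v \<and>
     (upper_letter i \<in> set v \<longrightarrow> lower_letter i \<in> set v) \<and>
     (lower_letter i \<in> set u \<longrightarrow> upper_letter i \<in> set u)"
proof -
  note rules = f_word_Cons_neg[OF assms(1,2)] eps_word_Cons_neg[OF assms(1,2)]
  have prefix: "eps_word i (u @ x) \<le> eps_word i x" if "upper_letter i \<notin> set u" for u x
    using that
  proof (induction u)
    case (Cons b u)
    then show ?case using eps_word_nonneg_value[OF assms(2), of x] by (auto simp: rules)
  qed simp
  have zero: "lower_letter i \<in> set v" if "eps_word i v = 0" "upper_letter i \<in> set v" for v
    using that
  proof (induction v)
    case (Cons b v)
    then show ?case using eps_word_nonneg_value[OF assms(2), of v] by (auto simp: rules split: if_splits)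
  qed simp
  have "\<exists>u v. w = u @ lower_letter i # v \<and> w' = u @ upper_letter i # v \<and> eps_word i v = 0 \<and>
     (lower_letter i \<in> set u \<longrightarrow> upper_letter i \<in> set u)" (is "?P w w'")
    using assms(3)
  proof (induction w arbitrary: w')
    case (Cons b w)
    show ?case
    proof (cases "b = lower_letter i \<and> eps_word i w = 0")
      case True
      then show ?thesis using Cons.prems by (intro exI[of _ "[]"] exI[of _ w]) (auto simp: rules)
    next
      case False
      then obtain w'' where w'': "w' = b # w''" "f_word i w = Some w''"
        using Cons.prems by (auto simp: rules simp del: f_word.simps)
      then obtain u v where uv: "w = u @ lower_letter i # v" "w'' = u @ upper_letter i # v"
        "eps_word i v = 0" "lower_letter i \<in> set u \<longrightarrow> upper_letter i \<in> set u"
        using Cons.IH by blast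
      \<comment> \<open>The head was passed over because a bracket is open behind it. None is open
        in \<open>lower_letter i # v\<close>, so the bracket comes from u.\<close>
      have "upper_letter i \<in> set u" if "b = lower_letter i"
      proof (rule ccontr)
        assume "upper_letter i \<notin> set u"
        then have "eps_word i w \<le> eps_word i (lower_letter i # v)" using prefix uv(1) by blast
        also have "\<dots> = 0" using uv(3) lower_less_upper[of i] by (simp add: rules)
        finally show False using False that eps_word_nonneg_value[OF assms(2), of w] by simp
      qed
      then show ?thesis using uv w''(1) by (intro exI[of _ "b # u"] exI[of _ v]) auto
    qed
  qed simp
  then show ?thesis using zero by blast
qed

lemma f_word_split:
  assumes "i \<in> simple_indices m n" "f_word i w = Some w'"
  obtains u v where "w = u @ lower_letter i # v" "w' = u @ upper_letter i # v"
proof (cases "i < 0")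
  case True
  then show ?thesis using f_word_neg_split[OF assms(1) True assms(2)] that by blast
next
  case False
  then have "0 \<le> i" by simp
  then show ?thesis using f_word_nonneg_iff[OF assms(1)] assms(2) that by blast
qed

text \<open>For i \<ge> 0 the changed letter is still the first (or last) letter of the root in the
  image, so the image locates it.\<close>

lemma f_word_inj:
  assumes "i \<in> simple_indices m n" "f_word i u = Some w" "f_word i v = Some w"
  shows "u = v"
proof (cases "i < 0")
  case True
  then show ?thesis using f_word_neg_inj[OF assms(1) True assms(2,3)] by blast
next
  case False
  then have i: "0 \<le> i" by simp
  show ?thesis using assms(2,3)
  proof (induction w arbitrary: u v)
    case Nil
    then show ?case by (auto dest!: length_f_word)
  next
    case (Cons c w)
    obtain a x b y where uv: "u = a # x" "v = b # y"
      using Cons.prems by (cases u; cases v) auto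
    have "set z \<inter> {lower_letter i, upper_letter i} \<noteq> {} \<and>
          set w \<inter> {lower_letter i, upper_letter i} \<noteq> {}" if "f_word i z = Some w" for z
      using f_word_split[OF assms(1) that] by (metis Int_iff empty_iff in_set_conv_decomp insertCI)
    then show ?case
      using Cons lower_less_upper[of i]
      by (auto simp: uv f_word_Cons_nonneg[OF assms(1) i] split: if_splits)
  qed
qed

subsection \<open>Closed sets of words and their characters\<close>

definition crystal_closed :: "nat \<Rightarrow> rat \<Rightarrow> rat list set \<Rightarrow> bool" where
  "crystal_closed m n X \<longleftrightarrow> finite X \<and> X \<subseteq> words m n \<and>
     (\<forall>i\<in>simple_indices m n. \<forall>w w'. f_word i w = Some w' \<longrightarrow> (w \<in> X \<longleftrightarrow> w' \<in> X))"

lemma crystal_closedD: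
  assumes "crystal_closed m n X"
  shows "finite X" "X \<subseteq> words m n"
    "i \<in> simple_indices m n \<Longrightarrow> f_word i w = Some w' \<Longrightarrow> w \<in> X \<longleftrightarrow> w' \<in> X"
  using assms by (auto simp: crystal_closed_def)

lemma component_refl: "w \<in> component m n w"
  by (simp add: component_def)

lemma component_eq:
  assumes "v \<in> component m n w"
  shows "component m n v = component m n w"
proof -
  let ?E = "(crystal_edges m n \<union> (crystal_edges m n)\<inverse>)\<^sup>*"
  have "sym ?E" by (rule sym_rtrancl) (auto simp: sym_def)
  moreover have "(w, v) \<in> ?E" using assms by (simp add: component_def)
  ultimately have "(v, w) \<in> ?E" by (rule symD)
  then show ?thesis using \<open>(w, v) \<in> ?E\<close> unfolding component_def by (auto intro: rtrancl_trans)
qed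

lemma component_subset_closed:
  assumes "crystal_closed m n X" "w \<in> X"
  shows "component m n w \<subseteq> X"
proof
  fix v assume "v \<in> component m n w"
  then have "(w, v) \<in> (crystal_edges m n \<union> (crystal_edges m n)\<inverse>)\<^sup>*" by (simp add: component_def)
  then show "v \<in> X"
    by (induction rule: rtrancl_induct)
      (use assms(2) crystal_closedD(3)[OF assms(1)] in \<open>auto simp: crystal_edges_def\<close>)
qed

text \<open>Components are disjoint, so the sum over X splits; single components never have to be
  identified.\<close>

lemma ch_closed_in_char_span:
  assumes "crystal_closed m n X"
  shows "ch X \<in> char_span m n"
proof -
  have X: "X = \<Union> (component m n ` X)"
    using component_subset_closed[OF assms] component_refl by fast
  have "ch X = sum (sum (\<lambda>w. zmonom (wt w))) (component m n ` X)"
  proof (subst X, unfold ch_def, rule sum.Union_disjoint[unfolded comp_def])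
    show "\<forall>A\<in>component m n ` X. finite A"
      using crystal_closedD(2)[OF assms] finite_component by blast
    show "\<forall>A\<in>component m n ` X. \<forall>B\<in>component m n ` X. A \<noteq> B \<longrightarrow> A \<inter> B = {}"
      using component_eq[of _ m n] by (smt (verit) disjoint_iff imageE)
  qed
  also have "\<dots> = (\<Sum>C\<in>component m n ` X. ch C)" by (simp add: ch_def)
  also have "\<dots> \<in> char_span m n"
    unfolding char_span_def
    by (intro zscale.span_sum zscale.span_base) (use crystal_closedD(2)[OF assms] in blast)
  finally show ?thesis .
qed

text \<open>Phrased with a relation so that powers of the partial map given by an operator can be
  used forwards and backwards.\<close>

lemma card_le_by_relation:
  assumes "finite B" "\<And>a. a \<in> A \<Longrightarrow> \<exists>b\<in>B. R a b"
    "\<And>a a' b. R a b \<Longrightarrow> R a' b \<Longrightarrow> a = a'"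
  shows "card A \<le> card B"
proof -
  obtain g where g: "\<And>a. a \<in> A \<Longrightarrow> g a \<in> B \<and> R a (g a)" using assms(2) by metis
  then have "inj_on g A" using assms(3) by (metis inj_onI)
  then show ?thesis using g assms(1) by (intro card_inj_on_le[of g]) auto
qed

section \<open>Reflection of strings of negative index\<close>

context
  fixes m :: nat and n i :: rat
  assumes i: "i \<in> simple_indices m n" "i < 0"
begin

private abbreviation "F \<equiv> {(w, w'). f_word i w = Some w'}"

lemma f_power_effect:
  assumes "(w, w') \<in> F ^^ j"
  shows "eps_word i w' = eps_word i w + int j"
    and "count_list w' (lower_letter i) + j = count_list w (lower_letter i)"
    and "count_list w' (upper_letter i) = count_list w (upper_letter i) + j"
    and "b \<noteq> lower_letter i \<Longrightarrow> b \<noteq> upper_letter i \<Longrightarrow> count_list w' b = count_list w b"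
    and "crystal_closed m n X \<Longrightarrow> w \<in> X \<longleftrightarrow> w' \<in> X"
proof -
  have "eps_word i w' = eps_word i w + int j \<and>
    count_list w' (lower_letter i) + j = count_list w (lower_letter i) \<and>
    count_list w' (upper_letter i) = count_list w (upper_letter i) + j \<and>
    (b \<noteq> lower_letter i \<longrightarrow> b \<noteq> upper_letter i \<longrightarrow> count_list w' b = count_list w b) \<and>
    (crystal_closed m n X \<longrightarrow> w \<in> X \<longleftrightarrow> w' \<in> X)"
    using assms
  proof (induction j arbitrary: w')
    case (Suc j)
    then obtain z where z: "(w, z) \<in> F ^^ j" "f_word i z = Some w'" by auto
    obtain u v where uv: "z = u @ lower_letter i # v" "w' = u @ upper_letter i # v"
      using f_word_split[OF i(1) z(2)] .
    show ?case using Suc.IH[OF z(1)] eps_f_word[OF i z(2)] lower_less_upper[of i]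
        crystal_closedD(3)[of m n X i z w'] i(1) z(2)
      by (auto simp: uv)
  qed simp
  then show "eps_word i w' = eps_word i w + int j"
    and "count_list w' (lower_letter i) + j = count_list w (lower_letter i)"
    and "count_list w' (upper_letter i) = count_list w (upper_letter i) + j"
    and "b \<noteq> lower_letter i \<Longrightarrow> b \<noteq> upper_letter i \<Longrightarrow> count_list w' b = count_list w b"
    and "crystal_closed m n X \<Longrightarrow> w \<in> X \<longleftrightarrow> w' \<in> X" by auto
qed

lemma f_power_defined:
  "int j \<le> eps_word i w + int (count_list w (lower_letter i)) - int (count_list w (upper_letter i))
    \<Longrightarrow> \<exists>w'. (w, w') \<in> F ^^ j"
proof (induction j)
  case (Suc j)
  then obtain z where z: "(w, z) \<in> F ^^ j" by force
  have "f_word i z \<noteq> None"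
    using f_power_effect(1-3)[OF z] Suc.prems by (intro f_word_neg_defined[OF i]) linarith
  then show ?case using z by auto
qed simp

lemma f_power_preimage: "int j \<le> eps_word i w' \<Longrightarrow> \<exists>w. (w, w') \<in> F ^^ j"
proof (induction j arbitrary: w')
  case (Suc j)
  then obtain z where z: "f_word i z = Some w'" using f_word_neg_surj[OF i, of w'] by auto
  have "int j \<le> eps_word i z" using eps_f_word[OF i z] Suc.prems by simp
  then obtain w where "(w, z) \<in> F ^^ j" using Suc.IH by blast
  then show ?case using z by auto
qed simp

lemma f_power_functional: "(w, w') \<in> F ^^ j \<Longrightarrow> (w, w'') \<in> F ^^ j \<Longrightarrow> w' = w''"
proof (induction j arbitrary: w' w'')
  case (Suc j)
  then obtain z z' where z: "(w, z) \<in> F ^^ j" "f_word i z = Some w'"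
    "(w, z') \<in> F ^^ j" "f_word i z' = Some w''" by auto
  then show ?case using Suc.IH[OF z(1,3)] by simp
qed simp

lemma f_power_inj: "(w, w') \<in> F ^^ j \<Longrightarrow> (w'', w') \<in> F ^^ j \<Longrightarrow> w = w''"
proof (induction j arbitrary: w')
  case (Suc j)
  then obtain z z' where z: "(w, z) \<in> F ^^ j" "f_word i z = Some w'"
    "(w'', z') \<in> F ^^ j" "f_word i z' = Some w'" by auto
  then have "z = z'" using f_word_inj[OF i(1)] by blast
  then show ?case using Suc.IH z by blast
qed simp

text \<open>Each \<open>i\<close>-string is reflected by \<open>f\<^sub>i\<close> to the power \<open>(\<alpha>\<^sub>i, \<mu>)\<close>.\<close>

lemma card_weight_reflect:
  assumes X: "crystal_closed m n X"
    and j: "Poly_Mapping.lookup \<mu> (lower_letter i) = Poly_Mapping.lookup \<mu> (upper_letter i) + j"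
    and \<nu>: "\<And>b. Poly_Mapping.lookup \<nu> b =
      Poly_Mapping.lookup \<mu> (Transposition.transpose (lower_letter i) (upper_letter i) b)"
  shows "card {w \<in> X. expo w = \<mu>} = card {w \<in> X. expo w = \<nu>}"
proof (rule antisym)
  let ?A = "{w \<in> X. expo w = \<mu>}" and ?B = "{w \<in> X. expo w = \<nu>}"
  have fin: "finite ?A" "finite ?B" using crystal_closedD(1)[OF X] by auto
  have e: "expo w = \<mu> \<longleftrightarrow> (\<forall>b. count_list w b = Poly_Mapping.lookup \<mu> b)" for w \<mu>
    by (metis lookup_expo poly_mapping_eqI)
  \<comment> \<open>The power trades j lower letters for upper ones. Since j is the difference of
    the two exponents, this exchanges them.\<close>
  have AB: "w \<in> ?A \<longleftrightarrow> w' \<in> ?B" if "(w, w') \<in> F ^^ j" for w w'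
  proof -
    note eff = f_power_effect(2,3)[OF that] f_power_effect(4)[OF that] f_power_effect(5)[OF that X]
    have "count_list w b = Poly_Mapping.lookup \<mu> b" if "\<forall>b. count_list w' b = Poly_Mapping.lookup \<nu> b" for b
    proof -
      have "count_list w' (lower_letter i) = Poly_Mapping.lookup \<mu> (upper_letter i)"
        "count_list w' (upper_letter i) = Poly_Mapping.lookup \<mu> (lower_letter i)"
        using that \<nu> by auto
      moreover have "count_list w' b = Poly_Mapping.lookup \<mu> b" if "b \<noteq> lower_letter i" "b \<noteq> upper_letter i"
        using that \<open>\<forall>b. _ b\<close> \<nu> by (auto simp: transpose_def)
      ultimately show ?thesis using eff(1,2) eff(3)[of b] j by (metis add_right_cancel)
    qed
    moreover have "count_list w' b = Poly_Mapping.lookup \<nu> b" if "\<forall>b. count_list w b = Poly_Mapping.lookup \<mu> b" for b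
      using that eff(1,2) eff(3)[of b] j by (auto simp: \<nu> transpose_def)
    ultimately show ?thesis using eff(4) by (auto simp: e)
  qed
  show "card ?A \<le> card ?B"
  proof (rule card_le_by_relation[where R = "\<lambda>w w'. (w, w') \<in> F ^^ j"])
    fix w assume w: "w \<in> ?A"
    \<comment> \<open>The counts differ by j, so \<open>phi\<close> is at least j.\<close>
    then have "int j \<le> eps_word i w + int (count_list w (lower_letter i)) - int (count_list w (upper_letter i))"
      using j eps_word_nonneg_value[OF i(2), of w] by (auto simp: lookup_expo)
    then obtain w' where "(w, w') \<in> F ^^ j" using f_power_defined by blast
    then show "\<exists>w'\<in>?B. (w, w') \<in> F ^^ j" using AB w by blast
  qed (use fin f_power_inj in blast)+
  show "card ?B \<le> card ?A"
  proof (rule card_le_by_relation[where R = "\<lambda>w' w. (w, w') \<in> F ^^ j"])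
    fix w' assume w': "w' \<in> ?B"
    \<comment> \<open>The counts now differ by j the other way, and nonnegativity of
      \<open>phi\<close> makes \<open>eps_word\<close> at least j.\<close>
    then have "int j \<le> eps_word i w'"
      using j eps_word_lower_bound[OF i, of w'] by (auto simp: \<nu> simp flip: lookup_expo)
    then obtain w where "(w, w') \<in> F ^^ j" using f_power_preimage by blast
    then show "\<exists>w\<in>?A. (w, w') \<in> F ^^ j" using AB w' by blast
  qed (use fin f_power_functional in blast)+
qed

text \<open>The preceding lemma wants the larger exponent on the lower letter. Otherwise \<mu> and
  \<nu> exchange roles, a transposition being its own inverse.\<close>

lemma lookup_ch_reflect:
  assumes X: "crystal_closed m n X"
    and \<nu>: "\<And>b. Poly_Mapping.lookup \<nu> b =
      Poly_Mapping.lookup \<mu> (Transposition.transpose (lower_letter i) (upper_letter i) b)"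
  shows "Poly_Mapping.lookup (ch X) \<nu> = Poly_Mapping.lookup (ch X) \<mu>"
proof (cases "Poly_Mapping.lookup \<mu> (upper_letter i) \<le> Poly_Mapping.lookup \<mu> (lower_letter i)")
  case True
  then show ?thesis
    using card_weight_reflect[OF X _ \<nu>] by (auto simp: lookup_ch[OF crystal_closedD(1)[OF X]] le_iff_add)
next
  case False
  then obtain j where j: "Poly_Mapping.lookup \<mu> (upper_letter i) = Poly_Mapping.lookup \<mu> (lower_letter i) + j"
    by (metis le_iff_add nle_le)
  have "card {w \<in> X. expo w = \<nu>} = card {w \<in> X. expo w = \<mu>}"
  proof (rule card_weight_reflect[OF X])
    show "Poly_Mapping.lookup \<nu> (lower_letter i) = Poly_Mapping.lookup \<nu> (upper_letter i) + j"
      using j by (simp add: \<nu>)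
    show "Poly_Mapping.lookup \<mu> b =
        Poly_Mapping.lookup \<nu> (Transposition.transpose (lower_letter i) (upper_letter i) b)" for b
      unfolding \<nu> by simp
  qed
  then show ?thesis by (simp add: lookup_ch[OF crystal_closedD(1)[OF X]])
qed

end

section \<open>Cancellation under the specialization\<close>

lemma zsubst_sum: "zsubst g (sum p A) = (\<Sum>a\<in>A. zsubst g (p a))"
  by (induction A rule: infinite_finite_induct) (auto simp: zsubst_add)

lemma zsubst_single: "zsubst g (Poly_Mapping.single \<mu> 1) =
    (\<Prod>b\<in>Poly_Mapping.keys \<mu>. g b ^ Poly_Mapping.lookup \<mu> b)"
  by (simp add: zsubst_def)

lemma zsubst_word: "zsubst g (zmonom (wt w)) = prod_list (map g w)"
proof -
  have "zsubst g (zmonom (wt w)) = (\<Prod>b\<in>set w. g b ^ count_list w b)"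
    by (simp add: zmonom_wt zsubst_single keys_expo lookup_expo)
  also have "\<dots> = prod_mset (image_mset g (mset w))"
    by (simp add: image_prod_mset_multiplicity count_mset)
  also have "\<dots> = prod_list (map g w)" by (metis mset_map prod_mset_prod_list)
  finally show ?thesis .
qed

lemma zsubst_ch: "zsubst g (ch C) = (\<Sum>w\<in>C. prod_list (map g w))"
  by (simp add: ch_def zsubst_sum zsubst_word)

lemma prod_list_const_poly: "prod_list (map (\<lambda>b. [:h b:]) w) = [:prod_list (map h w):]"
  by (induction w) (auto simp: mult.commute)

text \<open>The words containing a letter \<open>lower_letter i\<close> or \<open>upper_letter i\<close> are matched by \<open>f\<^sub>i\<close>, and the
  contributions of two matched words to the specialization cancel.\<close>

lemma specialize_ch_independent:
  assumes X: "crystal_closed m n X" and i: "i \<in> simple_indices m n" "0 \<le> i"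
  shows "independent_of_t (specialize (lower_letter i) (upper_letter i) (ch X))"
proof -
  let ?r = "lower_letter i" and ?s = "upper_letter i"
  define g where "g = (\<lambda>b. if b = ?r then [:0, 1:] else if b = ?s then - [:0, 1:] else [:zvar b:])"
  define val where "val = (\<lambda>w. prod_list (map g w))"
  define A where "A = {w \<in> X. f_word i w \<noteq> None}"
  define B where "B = {w' \<in> X. \<exists>w. f_word i w = Some w'}"
  have fin: "finite X" using crystal_closedD(1)[OF X] .
  have neg: "val w' = - val w" if w: "f_word i w = Some w'" for w w'
  proof -
    obtain u v where "w = u @ ?r # v" "w' = u @ ?s # v" using f_word_split[OF i(1) w] .
    moreover have "g ?s = - g ?r" using lower_less_upper[of i] by (simp add: g_def)
    ultimately show ?thesis by (simp add: val_def)
  qed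
  have bij: "bij_betw (\<lambda>w. the (f_word i w)) A B"
  proof (rule bij_betwI')
    fix x y assume "x \<in> A" "y \<in> A"
    then show "the (f_word i x) = the (f_word i y) \<longleftrightarrow> x = y"
      unfolding A_def using f_word_inj[OF i(1), of x _ y] by force
  next
    fix x assume "x \<in> A"
    then show "the (f_word i x) \<in> B"
      using crystal_closedD(3)[OF X i(1), of x "the (f_word i x)"] by (auto simp: A_def B_def)
  next
    fix y assume "y \<in> B"
    then obtain x where x: "f_word i x = Some y" "x \<in> X"
      unfolding B_def using crystal_closedD(3)[OF X i(1)] by blast
    then show "\<exists>x\<in>A. y = the (f_word i x)" by (intro bexI[of _ x]) (auto simp: A_def)
  qed
  \<comment> \<open>Where the operator is defined, the first (or last) letter of the root is the
    lower one; in its image it is the upper one.\<close>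
  have disj: "A \<inter> B = {}"
  proof -
    have False if fw: "f_word i w = Some w'" "f_word i v = Some w" for v w w'
    proof -
      have "?r \<noteq> ?s" using lower_less_upper[of i] by simp
      moreover obtain u1 v1 where 1: "w = u1 @ ?r # v1"
        "(if i \<in> \<int> then set u1 else set v1) \<inter> {?r, ?s} = {}"
        using fw(1)[unfolded f_word_nonneg_iff[OF i]] by blast
      moreover obtain u2 v2 where 2: "w = u2 @ ?s # v2"
        "(if i \<in> \<int> then set u2 else set v2) \<inter> {?r, ?s} = {}"
        using fw(2)[unfolded f_word_nonneg_iff[OF i]] by blast
      ultimately have "u1 @ ?r # v1 = u2 @ ?s # v2" by metis
      then show False using 1(2) 2(2) \<open>?r \<noteq> ?s\<close>
        by (auto simp: append_eq_append_conv2 append_eq_Cons_conv Cons_eq_append_conv split: if_splits)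
    qed
    then show ?thesis unfolding A_def B_def by blast
  qed
  \<comment> \<open>A word with some letter of the root lies in A or B, according to which of the
    two comes first (or last). All other words are free of t.\<close>
  have rest: "\<exists>c. val w = [:c:]" if "w \<in> X - (A \<union> B)" for w
  proof -
    have "set w \<inter> {?r, ?s} = {}"
    proof (rule ccontr)
      assume "set w \<inter> {?r, ?s} \<noteq> {}"
      then have ex: "\<exists>x\<in>set w. x \<in> {?r, ?s}" by blast
      have "\<exists>u x v. w = u @ x # v \<and> x \<in> {?r, ?s} \<and> (if i \<in> \<int> then set u else set v) \<inter> {?r, ?s} = {}"
      proof (cases "i \<in> \<int>")
        case True
        then show ?thesis using split_list_first_prop[OF ex] by (auto simp: disjoint_iff)
      next
        case False
        then show ?thesis using split_list_last_prop[OF ex] by (auto simp: disjoint_iff)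
      qed
      then obtain u x v where w: "w = u @ x # v" "x \<in> {?r, ?s}"
        "(if i \<in> \<int> then set u else set v) \<inter> {?r, ?s} = {}" by blast
      then have "f_word i (u @ ?r # v) = Some (u @ ?s # v)"
        unfolding f_word_nonneg_iff[OF i] by blast
      then have "w \<in> A \<union> B" using w(1,2) that by (auto simp: A_def B_def)
      then show False using that by blast
    qed
    then have "map g w = map (\<lambda>b. [:zvar b:]) w" by (auto simp: g_def)
    then show ?thesis unfolding val_def by (metis prod_list_const_poly)
  qed
  have "specialize ?r ?s (ch X) = sum val X"
    by (simp add: specialize_def zsubst_ch val_def g_def)
  also have "\<dots> = sum val (A \<union> B) + sum val (X - (A \<union> B))"
    using fin by (intro sum.subset_diff[THEN trans[OF _ add.commute]]) (auto simp: A_def B_def)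
  also have "sum val (A \<union> B) = sum val A + sum val B"
    using fin disj by (intro sum.union_disjoint) (auto simp: A_def B_def)
  also have "sum val B = (\<Sum>w\<in>A. val (the (f_word i w)))"
    by (rule sum.reindex_bij_betw[OF bij, symmetric])
  also have "\<dots> = (\<Sum>w\<in>A. - val w)"
  proof (rule sum.cong)
    fix w assume "w \<in> A"
    then obtain w' where "f_word i w = Some w'" by (auto simp: A_def)
    then show "val (the (f_word i w)) = - val w" by (metis neg option.sel)
  qed simp
  also have "sum val A + (\<Sum>w\<in>A. - val w) = 0" by (simp add: sum_negf)
  finally have "specialize ?r ?s (ch X) = sum val (X - (A \<union> B))" by simp
  moreover have "degree (sum val (X - (A \<union> B))) \<le> 0"
    using rest by (intro degree_sum_le) (use fin in simp, metis degree_pCons_0 le_refl)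
  ultimately show ?thesis by (simp add: independent_of_t_def)
qed

subsection \<open>Characters satisfy the two conditions\<close>

text \<open>Symmetry expressed through coefficients, the form in which strings prove it.\<close>

definition expo_invariant :: "zpoly \<Rightarrow> (rat \<Rightarrow> rat) \<Rightarrow> bool" where
  "expo_invariant f \<sigma> \<longleftrightarrow> (\<forall>\<mu> \<nu>.
     (\<forall>b. Poly_Mapping.lookup \<nu> b = Poly_Mapping.lookup \<mu> (\<sigma> b)) \<longrightarrow>
     Poly_Mapping.lookup f \<nu> = Poly_Mapping.lookup f \<mu>)"

text \<open>The substitution carries \<kappa> to its composite with the inverse of \<sigma>. This is
  injective, so only the term \<nu> of f reaches \<mu>.\<close>

lemma lookup_zsubst_permute:
  assumes "bij \<sigma>" "\<And>b. Poly_Mapping.lookup \<nu> b = Poly_Mapping.lookup \<mu> (\<sigma> b)"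
  shows "Poly_Mapping.lookup (zsubst (\<lambda>b. zvar (\<sigma> b)) f) \<mu> = Poly_Mapping.lookup f \<nu>"
proof -
  have mono: "(\<Prod>b\<in>Poly_Mapping.keys \<kappa>. zvar (\<sigma> b) ^ Poly_Mapping.lookup \<kappa> b) =
      Poly_Mapping.single (Poly_Mapping.map_key (inv \<sigma>) \<kappa>) 1" for \<kappa>
  proof -
    have inj: "inj (inv \<sigma>)" using assms(1) by (simp add: bij_imp_bij_inv bij_is_inj)
    let ?\<kappa> = "Poly_Mapping.map_key (inv \<sigma>) \<kappa>"
    have l: "Poly_Mapping.lookup ?\<kappa> (\<sigma> b) = Poly_Mapping.lookup \<kappa> b" for b
      using assms(1) by (simp add: map_key.rep_eq[OF inj] bij_is_inj)
    have k: "\<sigma> ` Poly_Mapping.keys \<kappa> = Poly_Mapping.keys ?\<kappa>"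
      using assms(1) by (simp add: keys_map_key[OF inj] bij_vimage_eq_inv_image[OF bij_imp_bij_inv[OF assms(1)]] inv_inv_eq[OF assms(1)])
    have "(\<Prod>b\<in>Poly_Mapping.keys \<kappa>. zvar (\<sigma> b) ^ Poly_Mapping.lookup \<kappa> b) =
       (\<Prod>b\<in>\<sigma> ` Poly_Mapping.keys \<kappa>. zvar b ^ Poly_Mapping.lookup ?\<kappa> b)"
      by (subst prod.reindex) (use inj_on_subset[OF bij_is_inj[OF assms(1)]] in \<open>simp_all add: l\<close>)
    then show ?thesis by (simp add: k prod_zvar sum_single_lookup)
  qed
  have eq: "Poly_Mapping.map_key (inv \<sigma>) \<kappa> = \<mu> \<longleftrightarrow> \<kappa> = \<nu>" for \<kappa>
  proof -
    have inj: "inj (inv \<sigma>)" using assms(1) by (simp add: bij_imp_bij_inv bij_is_inj)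
    have "Poly_Mapping.map_key (inv \<sigma>) \<kappa> = \<mu> \<longleftrightarrow>
        (\<forall>b. Poly_Mapping.lookup \<kappa> (inv \<sigma> b) = Poly_Mapping.lookup \<mu> b)"
      by (simp add: poly_mapping_eq_iff map_key.rep_eq[OF inj] fun_eq_iff)
    also have "\<dots> \<longleftrightarrow> (\<forall>b. Poly_Mapping.lookup \<kappa> b = Poly_Mapping.lookup \<mu> (\<sigma> b))"
      using assms(1) by (metis bij_inv_eq_iff)
    also have "\<dots> \<longleftrightarrow> \<kappa> = \<nu>"
      by (simp add: poly_mapping_eq_iff fun_eq_iff assms(2))
    finally show ?thesis .
  qed
  have s: "of_int c * Poly_Mapping.single \<kappa> (1::int) = Poly_Mapping.single \<kappa> c" for c and \<kappa> :: "rat \<Rightarrow>\<^sub>0 nat"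
    by (simp add: mult_single flip: single_of_int)
  have "zsubst (\<lambda>b. zvar (\<sigma> b)) f = (\<Sum>\<kappa>\<in>Poly_Mapping.keys f.
      Poly_Mapping.single (Poly_Mapping.map_key (inv \<sigma>) \<kappa>) (Poly_Mapping.lookup f \<kappa>))"
    unfolding zsubst_def mono s ..
  then have "Poly_Mapping.lookup (zsubst (\<lambda>b. zvar (\<sigma> b)) f) \<mu> =
      (\<Sum>\<kappa>\<in>Poly_Mapping.keys f. if \<kappa> = \<nu> then Poly_Mapping.lookup f \<kappa> else 0)"
    by (simp only: lookup_sum lookup_single when_def eq)
  then show ?thesis by (simp add: in_keys_iff)
qed

lemma symmetric_in_iff:
  "symmetric_in A f \<longleftrightarrow> (\<forall>\<sigma>. \<sigma> permutes A \<longrightarrow> expo_invariant f \<sigma>)"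
proof -
  have "zsubst (\<lambda>b. zvar (\<sigma> b)) f = f \<longleftrightarrow> expo_invariant f \<sigma>" if "\<sigma> permutes A" for \<sigma>
  proof -
    have bij: "bij \<sigma>" using that by (rule permutes_bij)
    have "zsubst (\<lambda>b. zvar (\<sigma> b)) f = f \<longleftrightarrow>
        (\<forall>\<mu>. Poly_Mapping.lookup (zsubst (\<lambda>b. zvar (\<sigma> b)) f) \<mu> = Poly_Mapping.lookup f \<mu>)"
      by (simp add: poly_mapping_eq_iff fun_eq_iff)
    also have "\<dots> \<longleftrightarrow> expo_invariant f \<sigma>"
    proof
      assume "expo_invariant f \<sigma>"
      show "\<forall>\<mu>. Poly_Mapping.lookup (zsubst (\<lambda>b. zvar (\<sigma> b)) f) \<mu> = Poly_Mapping.lookup f \<mu>"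
      proof
        fix \<mu> :: "rat \<Rightarrow>\<^sub>0 nat"
        have "\<And>b. Poly_Mapping.lookup (Poly_Mapping.map_key \<sigma> \<mu>) b = Poly_Mapping.lookup \<mu> (\<sigma> b)"
          using bij by (simp add: map_key.rep_eq bij_is_inj)
        then show "Poly_Mapping.lookup (zsubst (\<lambda>b. zvar (\<sigma> b)) f) \<mu> = Poly_Mapping.lookup f \<mu>"
          using lookup_zsubst_permute[OF bij] \<open>expo_invariant f \<sigma>\<close> unfolding expo_invariant_def by metis
      qed
    qed (use lookup_zsubst_permute[OF bij] in \<open>metis expo_invariant_def\<close>)
    finally show ?thesis .
  qed
  then show ?thesis by (auto simp: symmetric_in_def)
qed

lemma expo_invariant_comp:
  assumes "bij \<sigma>" "expo_invariant f \<sigma>" "expo_invariant f \<tau>"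
  shows "expo_invariant f (\<sigma> \<circ> \<tau>)"
  unfolding expo_invariant_def
proof (intro allI impI)
  fix \<mu> \<nu> :: "rat \<Rightarrow>\<^sub>0 nat"
  assume \<nu>: "\<forall>b. Poly_Mapping.lookup \<nu> b = Poly_Mapping.lookup \<mu> ((\<sigma> \<circ> \<tau>) b)"
  have l: "Poly_Mapping.lookup (Poly_Mapping.map_key \<sigma> \<mu>) b = Poly_Mapping.lookup \<mu> (\<sigma> b)" for b
    using assms(1) by (simp add: map_key.rep_eq bij_is_inj)
  have "Poly_Mapping.lookup f \<nu> = Poly_Mapping.lookup f (Poly_Mapping.map_key \<sigma> \<mu>)"
    using assms(3) \<nu> by (simp add: expo_invariant_def l)
  also have "\<dots> = Poly_Mapping.lookup f \<mu>"
    using assms(2) l by (simp add: expo_invariant_def)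
  finally show "Poly_Mapping.lookup f \<nu> = Poly_Mapping.lookup f \<mu>" .
qed

section \<open>Reduction of symmetry to adjacent letters\<close>

lemma negative_letters_eq:
  assumes "0 < n"
  shows "{b \<in> letters_upto m n. b < 0} = {b. b \<in> \<int> \<and> - of_nat m \<le> b \<and> b \<le> -1}"
proof (intro set_eqI iffI)
  fix b assume "b \<in> {b \<in> letters_upto m n. b < 0}"
  then have b: "b \<in> letters_upto m n" "b < 0" by simp_all
  show "b \<in> {b. b \<in> \<int> \<and> - of_nat m \<le> b \<and> b \<le> -1}"
    using b(2) by (cases rule: letter_cases[OF b(1)]) simp_all
next
  fix b :: rat assume "b \<in> {b. b \<in> \<int> \<and> - of_nat m \<le> b \<and> b \<le> -1}"
  then have b: "b \<in> \<int>" "- of_nat m \<le> b" "b \<le> -1" by simp_all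
  have "b < 0" using b(3) by linarith
  moreover have "b \<le> n" using b(3) assms by linarith
  ultimately show "b \<in> {b \<in> letters_upto m n. b < 0}"
    using b by (simp add: letters_upto_def letters_def)
qed

lemma negative_indexI:
  assumes "b \<in> \<int>" "- of_nat m \<le> b" "b + 1 \<le> -1"
  shows "b + 1 \<in> simple_indices m n" "b + 1 < 0" "lower_letter (b + 1) = b" "upper_letter (b + 1) = b + 1"
proof -
  show neg: "b + 1 < 0" using assms(3) by linarith
  then show "lower_letter (b + 1) = b" "upper_letter (b + 1) = b + 1"
    by (simp_all add: lower_letter_def upper_letter_def)
  have "b + 1 \<in> \<int>" "- of_nat m + 1 \<le> b + 1" using assms by simp_all
  then show "b + 1 \<in> simple_indices m n" using assms(3) unfolding simple_indices_def by blast
qed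

text \<open>Adjacent transpositions generate all permutations, and neighbouring negative letters are
  exactly the letters of the roots of negative index.\<close>

lemma symmetric_negative_letters_iff:
  assumes "0 < n" "2 * n \<in> \<int>"
  shows "symmetric_in {b \<in> letters_upto m n. b < 0} f \<longleftrightarrow>
   (\<forall>i\<in>simple_indices m n. i < 0 \<longrightarrow>
      expo_invariant f (Transposition.transpose (lower_letter i) (upper_letter i)))"
  (is "symmetric_in ?A f \<longleftrightarrow> ?R")
proof
  assume s: "symmetric_in ?A f"
  show ?R
  proof (intro ballI impI)
    fix i assume i: "i \<in> simple_indices m n" "i < 0"
    then have "upper_letter i < 0" by (simp add: upper_letter_def)
    then have "lower_letter i < 0" using lower_less_upper[of i] by linarith
    then have "lower_letter i \<in> ?A" "upper_letter i \<in> ?A"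
      using index_letters[OF i(1) assms] \<open>upper_letter i < 0\<close> by simp_all
    then show "expo_invariant f (Transposition.transpose (lower_letter i) (upper_letter i))"
      using s permutes_swap_id[of "lower_letter i" ?A "upper_letter i"] unfolding symmetric_in_iff by blast
  qed
next
  assume R: ?R
  have step: "expo_invariant f (Transposition.transpose b (b + 1))"
    if b: "b \<in> \<int>" "- of_nat m \<le> b" "b + 1 \<le> -1" for b
    using R negative_indexI[OF b] by metis
  \<comment> \<open>Induction on the distance, which is k + 1, so that k = 0 is the adjacent case.
    Conjugating by an adjacent transposition lengthens the swap by one step.\<close>
  have swap: "expo_invariant f (Transposition.transpose a (a + of_nat k + 1))"
    if "a \<in> \<int>" "- of_nat m \<le> a" "a + of_nat k + 1 \<le> -1" for a k
    using that
  proof (induction k)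
    case 0
    then show ?case using step[of a] by simp
  next
    case (Suc k)
    define c where "c = a + of_nat k + 1"
    have c: "c \<in> \<int>" using Suc.prems(1) by (simp add: c_def)
    have k: "(0::rat) \<le> of_nat k" "of_nat (Suc k) = (of_nat k + 1 :: rat)" by simp_all
    have c': "- of_nat m \<le> c" "c + 1 \<le> -1" "c \<le> -1" "a < c"
      using Suc.prems(2,3) k unfolding c_def k(2) by linarith+
    have eq: "Transposition.transpose c (c + 1) \<circ> (Transposition.transpose a c \<circ> Transposition.transpose c (c + 1))
       = Transposition.transpose a (c + 1)"
    proof
      fix x
      have "a \<noteq> c" "a \<noteq> c + 1" using c'(4) by linarith+
      then show "(Transposition.transpose c (c + 1) \<circ> (Transposition.transpose a c \<circ> Transposition.transpose c (c + 1))) x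
          = Transposition.transpose a (c + 1) x"
        by (cases "x = a"; cases "x = c"; cases "x = c + 1") (simp_all add: transpose_apply_other)
    qed
    have "expo_invariant f (Transposition.transpose a c)"
      using Suc.IH[OF Suc.prems(1,2)] c'(3) unfolding c_def by blast
    then have "expo_invariant f (Transposition.transpose c (c + 1) \<circ> (Transposition.transpose a c \<circ> Transposition.transpose c (c + 1)))"
      using step[OF c c'(1,2)] expo_invariant_comp[OF bij_transpose] by blast
    then have "expo_invariant f (Transposition.transpose a (c + 1))" unfolding eq .
    moreover have "a + of_nat (Suc k) + 1 = c + 1" unfolding c_def k(2) by simp
    ultimately show ?case by (simp only:)
  qed
  have swap': "expo_invariant f (Transposition.transpose a b)" if ab: "a \<in> ?A" "b \<in> ?A" "a < b" for a b
  proof -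
    have *: "a \<in> \<int>" "b \<in> \<int>" "- of_nat m \<le> a" "b \<le> -1"
      using ab unfolding negative_letters_eq[OF assms(1)] by simp_all
    then obtain k l where kl: "a = of_int k" "b = of_int l" by (metis Ints_cases)
    have "k < l" using ab(3) unfolding kl by simp
    then have "b = a + of_nat (nat (l - k - 1)) + 1" unfolding kl by simp
    then show ?thesis using swap[OF *(1,3), of "nat (l - k - 1)"] *(4) by metis
  qed
  show "symmetric_in ?A f"
    unfolding symmetric_in_iff
  proof (intro allI impI)
    fix \<sigma> assume "\<sigma> permutes ?A"
    moreover have "finite ?A" using finite_letters_upto by simp
    ultimately show "expo_invariant f \<sigma>"
    proof (induction rule: permutes_induct)
      case id
      have "\<nu> = \<mu>" if "\<forall>b. Poly_Mapping.lookup \<nu> b = Poly_Mapping.lookup \<mu> (id b)" for \<mu> \<nu> :: "rat \<Rightarrow>\<^sub>0 nat"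
        using that by (intro poly_mapping_eqI) simp
      then show ?case unfolding expo_invariant_def by blast
    next
      case (swap a b p)
      have "a < b \<or> b < a" using swap(3) by linarith
      then have "expo_invariant f (Transposition.transpose a b)"
        using swap'[OF swap(1,2)] swap'[OF swap(2,1)] transpose_commute[of a b] by metis
      from bij_transpose this swap.IH show ?case by (rule expo_invariant_comp)
    qed
  qed
qed

text \<open>Both conditions of the theorem indexed by simple roots, so that each operator accounts
  for one of them.\<close>

definition character_like :: "nat \<Rightarrow> rat \<Rightarrow> zpoly \<Rightarrow> bool" where
  "character_like m n f \<longleftrightarrow> (\<forall>i\<in>simple_indices m n.
     if i < 0 then expo_invariant f (Transposition.transpose (lower_letter i) (upper_letter i))
     else independent_of_t (specialize (lower_letter i) (upper_letter i) f))"

lemma nonneg_index_iff: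
  assumes "0 < n" "2 * n \<in> \<int>"
  shows "(\<exists>i\<in>simple_indices m n. 0 \<le> i \<and> r = lower_letter i \<and> s = upper_letter i) \<longleftrightarrow>
    r \<in> letters_upto m n \<and> s \<in> letters_upto m n \<and> ((r = -1 \<and> s = 1/2) \<or> (0 < r \<and> s = r + 1/2))"
proof
  assume "\<exists>i\<in>simple_indices m n. 0 \<le> i \<and> r = lower_letter i \<and> s = upper_letter i"
  then obtain i where i: "i \<in> simple_indices m n" "0 \<le> i" "r = lower_letter i" "s = upper_letter i" by blast
  moreover have "i = 0 \<or> 0 < i" using i(2) by linarith
  ultimately show "r \<in> letters_upto m n \<and> s \<in> letters_upto m n \<and> ((r = -1 \<and> s = 1/2) \<or> (0 < r \<and> s = r + 1/2))"
    using index_letters[OF i(1) assms] by (auto simp: lower_letter_def upper_letter_def)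
next
  assume rs: "r \<in> letters_upto m n \<and> s \<in> letters_upto m n \<and> ((r = -1 \<and> s = 1/2) \<or> (0 < r \<and> s = r + 1/2))"
  then have r: "r \<in> letters_upto m n" and s: "s \<in> letters_upto m n" by simp_all
  consider "r = -1" "s = 1/2" | "0 < r" "s = r + 1/2" using rs by blast
  then show "\<exists>i\<in>simple_indices m n. 0 \<le> i \<and> r = lower_letter i \<and> s = upper_letter i"
  proof cases
    case 1
    have "of_nat m \<ge> (1::rat)" using 1(1) by (cases rule: letter_cases[OF r]) simp_all
    then show ?thesis using 1
      by (intro bexI[of _ 0]) (simp_all add: lower_letter_def upper_letter_def simple_indices_def)
  next
    case 2
    have "2 * r \<in> \<int>" using 2(1) by (cases rule: letter_cases[OF r]) simp_all
    moreover have "r + 1/2 \<le> n" using s 2(2) by (simp add: letters_upto_def)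
    ultimately show ?thesis using 2
      by (intro bexI[of _ r]) (simp_all add: lower_letter_def upper_letter_def simple_indices_def)
  qed
qed

lemma character_like_iff:
  assumes "0 < n" "2 * n \<in> \<int>"
  shows "character_like m n f \<longleftrightarrow>
    symmetric_in {b \<in> letters_upto m n. b < 0} f \<and>
    (\<forall>r \<in> letters_upto m n. \<forall>s \<in> letters_upto m n.
       (r = -1 \<and> s = 1/2) \<or> (0 < r \<and> s = r + 1/2) \<longrightarrow>
       independent_of_t (specialize r s f))"
proof -
  have "(\<forall>i\<in>simple_indices m n. \<not> i < 0 \<longrightarrow> P (lower_letter i) (upper_letter i)) \<longleftrightarrow>
    (\<forall>r s. (\<exists>i\<in>simple_indices m n. 0 \<le> i \<and> r = lower_letter i \<and> s = upper_letter i) \<longrightarrow> P r s)" for P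
    unfolding not_less by blast
  then have *: "(\<forall>i\<in>simple_indices m n. \<not> i < 0 \<longrightarrow> P (lower_letter i) (upper_letter i)) \<longleftrightarrow>
    (\<forall>r \<in> letters_upto m n. \<forall>s \<in> letters_upto m n.
       (r = -1 \<and> s = 1/2) \<or> (0 < r \<and> s = r + 1/2) \<longrightarrow> P r s)" for P
    unfolding nonneg_index_iff[OF assms] by blast
  have "(\<forall>i\<in>I. if i < 0 then A i else B i) \<longleftrightarrow>
      (\<forall>i\<in>I. i < 0 \<longrightarrow> A i) \<and> (\<forall>i\<in>I. \<not> i < 0 \<longrightarrow> B i)" for I :: "rat set" and A B
    by auto
  then show ?thesis
    unfolding character_like_def symmetric_negative_letters_iff[OF assms] *[symmetric] .
qed

section \<open>Linearity of the conditions, and the forward implication\<close>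

lemma zsubst_zscale: "zsubst g (zscale k f) = of_int k * zsubst g f"
proof -
  have "zsubst g (zscale k f) = (\<Sum>\<mu>\<in>Poly_Mapping.keys f. of_int (Poly_Mapping.lookup (zscale k f) \<mu>) *
        (\<Prod>b\<in>Poly_Mapping.keys \<mu>. g b ^ Poly_Mapping.lookup \<mu> b))"
    by (rule zsubst_superset) (auto simp: in_keys_iff)
  then show ?thesis by (simp add: zsubst_def sum_distrib_left mult.assoc)
qed

lemma character_like_add:
  assumes "character_like m n f" "character_like m n g"
  shows "character_like m n (f + g)"
proof -
  have "independent_of_t (p + q)" if "independent_of_t p" "independent_of_t q" for p q
    using that degree_add_le[of p 0 q] by (simp add: independent_of_t_def)
  moreover have "expo_invariant (f + g) \<sigma>" if "expo_invariant f \<sigma>" "expo_invariant g \<sigma>" for \<sigma>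
    using that unfolding expo_invariant_def lookup_add by metis
  ultimately show ?thesis using assms
    unfolding character_like_def specialize_def zsubst_add by (simp split: if_splits)
qed

lemma character_like_zscale:
  assumes "character_like m n f"
  shows "character_like m n (zscale k f)"
proof -
  have "independent_of_t (of_int k * p)" if "independent_of_t p" for p
    using that degree_mult_le[of "of_int k" p] by (simp add: independent_of_t_def)
  moreover have "expo_invariant (zscale k f) \<sigma>" if "expo_invariant f \<sigma>" for \<sigma>
    using that unfolding expo_invariant_def lookup_zscale by metis
  ultimately show ?thesis using assms
    unfolding character_like_def specialize_def zsubst_zscale by (simp split: if_splits)
qed

lemma character_like_ch:
  assumes "crystal_closed m n X"
  shows "character_like m n (ch X)"
  using specialize_ch_independent[OF assms] lookup_ch_reflect[OF _ _ assms]
  by (auto simp: character_like_def expo_invariant_def)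

text \<open>\<open>crystal_edges\<close> stays within the alphabet while
  \<open>crystal_closed\<close> speaks of all words. The two fit together because both letters of a
  simple root belong to the alphabet.\<close>

lemma crystal_closed_words:
  assumes "0 < n" "2 * n \<in> \<int>" "i \<in> simple_indices m n" "f_word i w = Some w'"
  shows "w \<in> words m n \<longleftrightarrow> w' \<in> words m n"
proof -
  obtain u v where "w = u @ lower_letter i # v" "w' = u @ upper_letter i # v"
    using f_word_split[OF assms(3,4)] .
  then show ?thesis using index_letters[OF assms(3,1,2)] by (auto simp: words_def)
qed

lemma component_closed:
  assumes "0 < n" "2 * n \<in> \<int>" "w \<in> words m n"
  shows "crystal_closed m n (component m n w)"
  unfolding crystal_closed_def
proof (intro conjI ballI allI impI)
  show sub: "component m n w \<subseteq> words m n"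
  proof
    fix v assume "v \<in> component m n w"
    then have "(w, v) \<in> (crystal_edges m n \<union> (crystal_edges m n)\<inverse>)\<^sup>*" by (simp add: component_def)
    then show "v \<in> words m n"
      by (induction rule: rtrancl_induct) (use assms(3) in \<open>auto simp: crystal_edges_def\<close>)
  qed
  fix i u v assume f: "i \<in> simple_indices m n" "f_word i u = Some v"
  have e: "(u, v) \<in> crystal_edges m n" if "u \<in> words m n \<or> v \<in> words m n"
    using that f crystal_closed_words[OF assms(1,2) f] by (auto simp: crystal_edges_def)
  show "u \<in> component m n w \<longleftrightarrow> v \<in> component m n w"
  proof
    assume "u \<in> component m n w"
    then show "v \<in> component m n w" using e sub
      by (auto simp: component_def intro: rtrancl_into_rtrancl)
  next
    assume "v \<in> component m n w"
    then show "u \<in> component m n w" using e sub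
      by (auto simp: component_def intro: rtrancl_into_rtrancl)
  qed
qed (rule finite_component[OF assms(3)])

lemma char_span_character_like:
  assumes "0 < n" "2 * n \<in> \<int>" "f \<in> char_span m n"
  shows "character_like m n f"
  using assms(3) unfolding char_span_def
proof (induction rule: zscale.span_induct_alt)
  case base
  show ?case by (simp add: character_like_def expo_invariant_def specialize_def independent_of_t_def)
next
  case (step c x y)
  then have "character_like m n x"
    using character_like_ch component_closed[OF assms(1,2)] by blast
  then show ?case using step by (intro character_like_add character_like_zscale)
qed

subsection \<open>Words with a prescribed inversion pattern\<close>

text \<open>The condition on entries of a column of a semistandard super tableau: even letters
  increase strictly, odd ones may repeat.\<close>

definition column_pair :: "rat \<Rightarrow> rat \<Rightarrow> bool" where
  "column_pair b c \<longleftrightarrow> b < c \<or> b = c \<and> b \<notin> \<int>"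

text \<open>All pairs of positions are recorded, since minimality compares a letter with a possibly
  distant copy of its predecessor.\<close>

definition pattern_class :: "nat \<Rightarrow> rat \<Rightarrow> rat list \<Rightarrow> rat list set" where
  "pattern_class m n w = {w' \<in> words m n. length w' = length w \<and>
     (\<forall>p q. p < q \<longrightarrow> q < length w \<longrightarrow> column_pair (w' ! p) (w' ! q) = column_pair (w ! p) (w ! q))}"

text \<open>Negative letters in increasing order, then positive even letters, then odd ones. With
  the support condition below, the first letter of a root of integral index i \<ge> 0, and the last
  one for half-integral i, is then the lower one.\<close>

definition source_key :: "rat \<Rightarrow> rat" where
  "source_key b = (if b < 0 then b else if b \<in> \<int> then 0 else 1)"

text \<open>Sorted words whose support is an initial segment of the alphabet are killed by all \<open>e\<^sub>i\<close>.\<close>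

definition source_word :: "nat \<Rightarrow> rat \<Rightarrow> rat list \<Rightarrow> bool" where
  "source_word m n w \<longleftrightarrow> w \<in> words m n \<and> sorted (map source_key w) \<and>
     (\<forall>b<0. count_list w b \<le> 1) \<and>
     (\<forall>i\<in>simple_indices m n. upper_letter i \<in> set w \<longrightarrow> lower_letter i \<in> set w)"

lemma words_nth: "w \<in> words m n \<Longrightarrow> p < length w \<Longrightarrow> w ! p \<in> letters_upto m n"
  by (auto simp: words_def in_lists_conv_set)

lemma count_list_two:
  assumes "p < q" "q < length w" "w ! p = b" "w ! q = b"
  shows "2 \<le> count_list w b"
proof -
  have "count_list w b = card {j. j < length w \<and> b = w ! j}"
    by (simp add: count_list_eq_length_filter length_filter_conv_card)
  moreover have "card {p, q} \<le> card {j. j < length w \<and> b = w ! j}"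
    using assms by (intro card_mono) auto
  ultimately show ?thesis using assms(1) by simp
qed

lemma pattern_classD:
  assumes "w' \<in> pattern_class m n w"
  shows "w' \<in> words m n" "length w' = length w"
    "p < q \<Longrightarrow> q < length w \<Longrightarrow> column_pair (w' ! p) (w' ! q) = column_pair (w ! p) (w ! q)"
  using assms unfolding pattern_class_def by blast+

lemma source_wordD:
  assumes "source_word m n w"
  shows "w \<in> words m n" "p < q \<Longrightarrow> q < length w \<Longrightarrow> source_key (w ! p) \<le> source_key (w ! q)"
    "b < 0 \<Longrightarrow> count_list w b \<le> 1"
    "i \<in> simple_indices m n \<Longrightarrow> upper_letter i \<in> set w \<Longrightarrow> lower_letter i \<in> set w"
proof -
  show "source_key (w ! p) \<le> source_key (w ! q)" if "p < q" "q < length w"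
  proof -
    have "sorted (map source_key w)" using assms unfolding source_word_def by blast
    then show ?thesis using sorted_nth_mono[of "map source_key w" p q] that by simp
  qed
qed (use assms in \<open>unfold source_word_def, blast\<close>)+

lemma source_word_negative:
  assumes "source_word m n w" "p < q" "q < length w" "w ! q < 0"
  shows "w ! p < w ! q"
proof -
  have "source_key (w ! p) \<le> source_key (w ! q)"
    using source_wordD(2)[OF assms(1-3)] .
  moreover have "source_key (w ! q) = w ! q" using assms(4) by (simp add: source_key_def)
  moreover have "w ! p \<le> source_key (w ! p) \<or> 0 \<le> source_key (w ! p)" by (simp add: source_key_def)
  ultimately have "w ! p \<le> w ! q" using assms(4) by linarith
  moreover have "w ! p \<noteq> w ! q"
  proof
    assume "w ! p = w ! q"
    then have "2 \<le> count_list w (w ! q)" using count_list_two[OF assms(2,3)] by blast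
    moreover have "count_list w (w ! q) \<le> 1" using source_wordD(3)[OF assms(1,4)] .
    ultimately show False by simp
  qed
  ultimately show ?thesis by simp
qed

text \<open>The form in which extremality of the source word enters: a copy of the predecessor
  stands on the side where the pattern can compare the two.\<close>

lemma source_word_lower:
  assumes w: "source_word m n w" and i: "i \<in> simple_indices m n" and p: "p < length w" "w ! p = upper_letter i"
  obtains q where "q < length w" "w ! q = lower_letter i" "if lower_letter i \<in> \<int> then q < p else p < q"
proof -
  have "upper_letter i \<in> set w" using p by (metis nth_mem)
  then have "lower_letter i \<in> set w" using source_wordD(4)[OF w i] by blast
  then obtain q where q: "q < length w" "w ! q = lower_letter i" by (metis in_set_conv_nth)
  have ne: "q \<noteq> p" using q(2) p(2) lower_less_upper[of i] by auto
  have mono: "source_key (w ! a) \<le> source_key (w ! b)" if "a < b" "b < length w" for a b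
    using source_wordD(2)[OF w that] .
  have "if lower_letter i \<in> \<int> then q < p else p < q"
  proof (cases "lower_letter i \<in> \<int>")
    case True
    have "\<not> p < q"
    proof
      assume "p < q"
      then have le: "source_key (upper_letter i) \<le> source_key (lower_letter i)" using mono[of p q] q p by simp
      show False
      proof (cases "i < 0")
        case True
        then show False using le by (simp add: source_key_def lower_letter_def upper_letter_def)
      next
        case False
        then have "upper_letter i \<notin> \<int>" "\<not> upper_letter i < 0"
          using True letter_parity(3,4)[OF i] by (simp_all add: upper_letter_def)
        then have "source_key (upper_letter i) = 1" by (simp add: source_key_def)
        moreover have "source_key (lower_letter i) \<le> 0" using True by (simp add: source_key_def)
        ultimately show False using le by simp
      qed
    qed
    then show ?thesis using True ne by simp
  next
    case False
    have i0: "\<not> i < 0" using letter_parity(1)[OF i] False by blast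
    then have "upper_letter i \<in> \<int>" "\<not> upper_letter i < 0"
      using False letter_parity(3,4)[OF i] by (simp_all add: upper_letter_def)
    moreover have "\<not> lower_letter i < 0" using i0 False by (simp add: lower_letter_def split: if_splits)
    ultimately have "\<not> source_key (lower_letter i) \<le> source_key (upper_letter i)"
      using False by (simp add: source_key_def)
    then have "\<not> q < p" using mono[of q p] q p by auto
    then show ?thesis using False ne by simp
  qed
  then show ?thesis using q that by blast
qed

text \<open>Induction on the rank of the letter \<open>w ! p\<close>. Its predecessor in the
  alphabet occurs in w at some q, where w' is already bounded below; the pattern transfers this
  bound to p with a strict inequality, and the next letter is \<open>w ! p\<close>.\<close>

lemma source_word_minimal:
  assumes w: "source_word m n w" and w': "w' \<in> pattern_class m n w" and "p < length w"
  shows "w ! p \<le> w' ! p"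
  using assms(3)
proof (induction "card {b \<in> letters_upto m n. b < w ! p}" arbitrary: p rule: less_induct)
  case less
  note wW = source_wordD(1)[OF w]
  note w'W = pattern_classD(1,2)[OF w']
  note pat = pattern_classD(3)[OF w']
  have letters: "w ! p \<in> letters_upto m n" "w' ! p \<in> letters_upto m n"
    using words_nth[OF wW] words_nth[OF w'W(1)] w'W(2) less.prems by simp_all
  show ?case
  proof (rule ccontr)
    assume "\<not> w ! p \<le> w' ! p"
    then have lt: "w' ! p < w ! p" by simp
    obtain i where i: "i \<in> simple_indices m n" "upper_letter i = w ! p"
      using predecessor_index[OF letters lt] .
    obtain q where q: "q < length w" "w ! q = lower_letter i"
      "if lower_letter i \<in> \<int> then q < p else p < q"
      using source_word_lower[OF w i(1) less.prems i(2)[symmetric]] .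
    have qp: "w ! q < w ! p" using q(2) i(2) lower_less_upper[of i] by simp
    have "{b \<in> letters_upto m n. b < w ! q} \<subset> {b \<in> letters_upto m n. b < w ! p}"
      using qp words_nth[OF wW q(1)] by auto
    then have "card {b \<in> letters_upto m n. b < w ! q} < card {b \<in> letters_upto m n. b < w ! p}"
      using finite_letters_upto by (intro psubset_card_mono) auto
    then have IH: "lower_letter i \<le> w' ! q" using less.hyps[OF _ q(1)] q(2) by simp
    \<comment> \<open>If \<open>w' ! q\<close> equals the lower letter, its parity lets the pattern
      exclude a tie between p and q.\<close>
    have "lower_letter i < w' ! p"
    proof (cases "lower_letter i \<in> \<int>")
      case True
      then have "column_pair (w' ! q) (w' ! p)"
        using pat[of q p] q(3) less.prems qp by (simp add: column_pair_def)
      then have "w' ! q < w' ! p \<or> w' ! q = w' ! p \<and> w' ! q \<notin> \<int>"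
        unfolding column_pair_def .
      then show ?thesis using IH True by (metis order_le_less order_less_trans)
    next
      case False
      then have "\<not> column_pair (w' ! p) (w' ! q)"
        using pat[of p q] q(1,3) qp by (simp add: column_pair_def)
      then have "w' ! q < w' ! p \<or> w' ! q = w' ! p \<and> w' ! p \<in> \<int>"
        unfolding column_pair_def by (metis linorder_less_linear)
      moreover have "lower_letter i \<noteq> w' ! q" if "w' ! q \<in> \<int>" using False that by metis
      ultimately show ?thesis using IH by (metis order_le_less order_less_trans)
    qed
    then have "w ! p \<le> w' ! p" using letter_ge_upper[OF i(1) letters(2)] i(2) by simp
    then show False using lt by simp
  qed
qed

lemma negative_letter_int: "b \<in> letters_upto m n \<Longrightarrow> b < 0 \<Longrightarrow> b \<in> \<int>"
  by (erule letter_cases) simp_all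

text \<open>By minimality \<open>w ! q\<close> is negative too, so p and q form a column pair in w,
  hence in w'. Negative letters are even, so the pair is strict.\<close>

lemma pattern_class_negative:
  assumes w: "source_word m n w" and w': "w' \<in> pattern_class m n w"
    and pq: "p < q" "q < length w" "w' ! q < 0"
  shows "w' ! p < w' ! q"
proof -
  have "w ! q < 0" using source_word_minimal[OF w w' pq(2)] pq(3) by simp
  then have "column_pair (w ! p) (w ! q)"
    using source_word_negative[OF w pq(1,2)] by (simp add: column_pair_def)
  then have "column_pair (w' ! p) (w' ! q)" using pattern_classD(3)[OF w' pq(1,2)] by simp
  moreover have "q < length w'" using pq(2) pattern_classD(2)[OF w'] by simp
  then have "w' ! q \<in> \<int>"
    using negative_letter_int[OF words_nth[OF pattern_classD(1)[OF w']] pq(3)] by blast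
  ultimately show ?thesis unfolding column_pair_def by metis
qed

lemma pattern_class_negative_split:
  assumes w: "source_word m n w" and "x @ c # y \<in> pattern_class m n w" "c < 0"
  shows "\<forall>b\<in>set x. b < c" "\<forall>b\<in>set y. b < 0 \<longrightarrow> c < b"
proof -
  have len: "length w = length x + Suc (length y)"
    using pattern_classD(2)[OF assms(2)] by simp
  show "\<forall>b\<in>set x. b < c"
  proof
    fix b assume "b \<in> set x"
    then obtain p where "p < length x" "x ! p = b" by (metis in_set_conv_nth)
    then show "b < c"
      using pattern_class_negative[OF w assms(2), of p "length x"] assms(3) len by (simp add: nth_append)
  qed
  show "\<forall>b\<in>set y. b < 0 \<longrightarrow> c < b"
  proof (intro ballI impI)
    fix b assume "b \<in> set y" "b < 0"
    then obtain q where "q < length y" "y ! q = b" by (metis in_set_conv_nth)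
    then show "c < b"
      using pattern_class_negative[OF w assms(2), of "length x" "length x + Suc q"] \<open>b < 0\<close> len
      by (simp add: nth_append)
  qed
qed

lemma column_pair_other:
  assumes "i \<in> simple_indices m n" "c \<in> letters_upto m n" "c \<noteq> lower_letter i" "c \<noteq> upper_letter i"
  shows "column_pair (lower_letter i) c = column_pair (upper_letter i) c"
    "column_pair c (lower_letter i) = column_pair c (upper_letter i)"
proof -
  have "c < lower_letter i \<or> upper_letter i < c"
    using letter_ge_upper[OF assms(1,2)] assms(3,4) by linarith
  then show "column_pair (lower_letter i) c = column_pair (upper_letter i) c"
    "column_pair c (lower_letter i) = column_pair c (upper_letter i)"
    using lower_less_upper[of i] unfolding column_pair_def by auto
qed

text \<open>Only copies of the two letters of the root could notice the change. Membership of either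
  end is allowed because closedness is needed in both directions.\<close>

lemma f_word_column_pair:
  assumes w: "source_word m n w" and i: "i \<in> simple_indices m n" and f: "f_word i u = Some v"
    and uW: "u \<in> words m n" and mem: "u \<in> pattern_class m n w \<or> v \<in> pattern_class m n w"
  shows "\<exists>x y. u = x @ lower_letter i # y \<and> v = x @ upper_letter i # y \<and>
    (\<forall>c\<in>set y. column_pair (lower_letter i) c = column_pair (upper_letter i) c) \<and>
    (\<forall>c\<in>set x. column_pair c (lower_letter i) = column_pair c (upper_letter i))"
proof (cases "i < 0")
  case True
  obtain x y where xy: "u = x @ lower_letter i # y" "v = x @ upper_letter i # y"
    "upper_letter i \<in> set y \<longrightarrow> lower_letter i \<in> set y" "lower_letter i \<in> set x \<longrightarrow> upper_letter i \<in> set x"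
    using f_word_neg_split[OF i True f] by blast
  have neg: "lower_letter i < 0" "upper_letter i < 0" using True by (simp_all add: lower_letter_def upper_letter_def)
  note lu = lower_less_upper[of i]
  have cl: "\<And>c. c \<in> set x \<Longrightarrow> c \<in> letters_upto m n" "\<And>c. c \<in> set y \<Longrightarrow> c \<in> letters_upto m n"
    using uW unfolding xy(1) words_def by auto
  \<comment> \<open>Strict increase excludes some copies of the two letters, the bracketing
    conditions the others.\<close>
  have "lower_letter i \<notin> set x \<and> lower_letter i \<notin> set y \<and> upper_letter i \<notin> set x \<and> upper_letter i \<notin> set y"
    using mem
  proof
    assume "u \<in> pattern_class m n w"
    then have "\<forall>b\<in>set x. b < lower_letter i" "\<forall>b\<in>set y. b < 0 \<longrightarrow> lower_letter i < b"
      using pattern_class_negative_split[OF w _ neg(1), of x y] unfolding xy(1) by blast+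
    then show ?thesis using xy(3) neg lu by (meson less_irrefl less_asym)
  next
    assume "v \<in> pattern_class m n w"
    then have "\<forall>b\<in>set x. b < upper_letter i" "\<forall>b\<in>set y. b < 0 \<longrightarrow> upper_letter i < b"
      using pattern_class_negative_split[OF w _ neg(2), of x y] unfolding xy(2) by blast+
    then show ?thesis using xy(4) neg lu by (meson less_irrefl less_asym)
  qed
  then have "\<And>c. c \<in> set y \<Longrightarrow> column_pair (lower_letter i) c = column_pair (upper_letter i) c"
    "\<And>c. c \<in> set x \<Longrightarrow> column_pair c (lower_letter i) = column_pair c (upper_letter i)"
    using column_pair_other[OF i cl(2)] column_pair_other[OF i cl(1)] by metis+
  then show ?thesis using xy(1,2) by blast
next
  case False
  then have i0: "0 \<le> i" by simp
  obtain x y where xy: "u = x @ lower_letter i # y" "v = x @ upper_letter i # y"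
    "(if i \<in> \<int> then set x else set y) \<inter> {lower_letter i, upper_letter i} = {}"
    using f[unfolded f_word_nonneg_iff[OF i i0]] by blast
  have cl: "\<And>c. c \<in> set x \<Longrightarrow> c \<in> letters_upto m n" "\<And>c. c \<in> set y \<Longrightarrow> c \<in> letters_upto m n"
    using uW unfolding xy(1) words_def by auto
  note par = letter_parity(3,4)[OF i i0] and lu = lower_less_upper[of i]
  \<comment> \<open>A copy to the right occurs only for integral i, where the lower letter is even
    and the upper odd: both are unpaired with a later lower letter and paired with a later upper
    one. The half-integral case is the mirror image.\<close>
  have "column_pair (lower_letter i) c = column_pair (upper_letter i) c" if c: "c \<in> set y" for c
  proof (cases "c = lower_letter i \<or> c = upper_letter i")
    case True
    then have "i \<in> \<int>" using xy(3) c by (auto split: if_splits)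
    then show ?thesis using True par lu by (auto simp: column_pair_def)
  qed (use column_pair_other(1)[OF i cl(2)[OF c]] in blast)
  moreover have "column_pair c (lower_letter i) = column_pair c (upper_letter i)" if c: "c \<in> set x" for c
  proof (cases "c = lower_letter i \<or> c = upper_letter i")
    case True
    then have "i \<notin> \<int>" using xy(3) c by (auto split: if_splits)
    then show ?thesis using True par lu by (auto simp: column_pair_def)
  qed (use column_pair_other(2)[OF i cl(1)[OF c]] in blast)
  ultimately show ?thesis using xy(1,2) by blast
qed

lemma replace_letter_pairs:
  assumes "\<forall>c\<in>set y. R a c = R b c" "\<forall>c\<in>set x. R c a = R c b"
    and pq: "p < q" "q < length (x @ a # y)"
  shows "R ((x @ a # y) ! p) ((x @ a # y) ! q) = R ((x @ b # y) ! p) ((x @ b # y) ! q)"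
proof -
  have other: "(x @ a # y) ! r = (x @ b # y) ! r" if "r \<noteq> length x" for r
    using that by (cases "r - length x") (auto simp: nth_append)
  consider "p \<noteq> length x" "q \<noteq> length x" | "p = length x" | "q = length x" by blast
  then show ?thesis
  proof cases
    case 1
    then show ?thesis by (simp only: other[OF 1(1)] other[OF 1(2)])
  next
    case 2
    then obtain r where r: "q = length x + Suc r" using pq(1) less_iff_Suc_add by auto
    then have "y ! r \<in> set y" using pq(2) by simp
    then show ?thesis using 2 r assms(1) by (simp add: nth_append)
  next
    case 3
    then show ?thesis using pq(1) assms(2) by (simp add: nth_append)
  qed
qed

lemma pattern_class_closed:
  assumes n: "0 < n" "2 * n \<in> \<int>" and w: "source_word m n w"
  shows "crystal_closed m n (pattern_class m n w)"
  unfolding crystal_closed_def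
proof (intro conjI ballI allI impI)
  show "finite (pattern_class m n w)"
  proof (rule finite_subset)
    show "pattern_class m n w \<subseteq> {w'. set w' \<subseteq> letters_upto m n \<and> length w' = length w}"
      by (auto simp: pattern_class_def words_def)
  qed (simp add: finite_lists_length_eq finite_letters_upto)
  show "pattern_class m n w \<subseteq> words m n" by (auto simp: pattern_class_def)
  fix i u v assume i: "i \<in> simple_indices m n" and f: "f_word i u = Some v"
  note W = crystal_closed_words[OF n i f]
  show "u \<in> pattern_class m n w \<longleftrightarrow> v \<in> pattern_class m n w"
  proof (rule ccontr)
    assume ne: "\<not> (u \<in> pattern_class m n w \<longleftrightarrow> v \<in> pattern_class m n w)"
    then have mem: "u \<in> pattern_class m n w \<or> v \<in> pattern_class m n w" by blast
    then have uW: "u \<in> words m n" using W pattern_classD(1) by blast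
    then have vW: "v \<in> words m n" using W by blast
    obtain x y where xy: "u = x @ lower_letter i # y" "v = x @ upper_letter i # y"
      and cp: "\<forall>c\<in>set y. column_pair (lower_letter i) c = column_pair (upper_letter i) c"
        "\<forall>c\<in>set x. column_pair c (lower_letter i) = column_pair c (upper_letter i)"
      using f_word_column_pair[OF w i f uW mem] by blast
    have len: "length u = length v" unfolding xy by simp
    have same: "column_pair (u ! p) (u ! q) = column_pair (v ! p) (v ! q)" if "p < q" "q < length u" for p q
      using replace_letter_pairs[OF cp] that unfolding xy by blast
    have lw: "length u = length w" using mem pattern_classD(2) len by metis
    have "v \<in> pattern_class m n w" if u: "u \<in> pattern_class m n w"
      unfolding pattern_class_def mem_Collect_eq
      using vW len lw same pattern_classD(3)[OF u] by simp
    moreover have "u \<in> pattern_class m n w" if v: "v \<in> pattern_class m n w"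
      unfolding pattern_class_def mem_Collect_eq
      using uW len lw same pattern_classD(3)[OF v] by simp
    ultimately show False using ne by blast
  qed
qed

subsection \<open>Leading exponents\<close>

text \<open>Exponents are compared at the smallest letter where they differ, so letterwise smaller
  words have larger exponents.\<close>

lemma expo_single_less:
  assumes "b < (b'::rat)"
  shows "Poly_Mapping.single b' (1::nat) < Poly_Mapping.single b 1"
proof -
  have "less_fun (Poly_Mapping.lookup (Poly_Mapping.single b' (1::nat))) (Poly_Mapping.lookup (Poly_Mapping.single b 1))"
    unfolding less_fun_def using assms by (intro exI[of _ b]) (auto simp: lookup_single when_def)
  then show ?thesis by (simp add: less_poly_mapping.rep_eq)
qed

lemma expo_antimono:
  assumes "list_all2 (\<le>) w w'"
  shows "expo w' \<le> expo w \<and> (w \<noteq> w' \<longrightarrow> expo w' < expo w)"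
  using assms
proof (induction rule: list_all2_induct)
  case (Cons b w b' w')
  show ?case
  proof (cases "b = b'")
    case True
    then show ?thesis using Cons.IH by (simp add: add_left_mono add_strict_left_mono)
  next
    case False
    then have "Poly_Mapping.single b' (1::nat) < Poly_Mapping.single b 1"
      using Cons.hyps expo_single_less by (simp add: less_le)
    then have "expo (b' # w') < expo (b # w)"
      using Cons.IH by (simp add: add_less_le_mono)
    then show ?thesis by simp
  qed
qed simp

text \<open>Equal lengths make the character homogeneous, which keeps degrees bounded during the
  subtraction.\<close>

definition leading_set :: "nat \<Rightarrow> rat \<Rightarrow> (rat \<Rightarrow>\<^sub>0 nat) \<Rightarrow> rat list set \<Rightarrow> bool" where
  "leading_set m n \<mu> X \<longleftrightarrow> crystal_closed m n X \<and>
     (\<exists>w\<in>X. expo w = \<mu> \<and> (\<forall>w'\<in>X. length w' = length w \<and> (w' \<noteq> w \<longrightarrow> expo w' < \<mu>)))"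

lemma leading_set_source_word:
  assumes "0 < n" "2 * n \<in> \<int>" "source_word m n w"
  shows "leading_set m n (expo w) (pattern_class m n w)"
  unfolding leading_set_def
proof (intro conjI bexI[of _ w] ballI)
  show "crystal_closed m n (pattern_class m n w)" using pattern_class_closed[OF assms] .
  show "w \<in> pattern_class m n w" using source_wordD(1)[OF assms(3)] by (simp add: pattern_class_def)
  fix w' assume w': "w' \<in> pattern_class m n w"
  show len: "length w' = length w" using pattern_classD(2)[OF w'] .
  have "list_all2 (\<le>) w w'"
    using source_word_minimal[OF assms(3) w'] len by (simp add: list_all2_conv_all_nth)
  then show "w' \<noteq> w \<longrightarrow> expo w' < expo w" using expo_antimono by blast
qed simp

lemma leading_set_Nil: "leading_set m n 0 {[]}"
proof -
  have "crystal_closed m n {[]}"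
    unfolding crystal_closed_def
  proof (intro conjI ballI allI impI)
    show "u \<in> {[]} \<longleftrightarrow> v \<in> {[]}" if "f_word i u = Some v" for i u v
      using length_f_word[OF that] by auto
  qed (simp_all add: words_def)
  then show ?thesis by (simp add: leading_set_def)
qed

lemma f_word_append_cases:
  assumes "i \<in> simple_indices m n" "f_word i (u @ v) = Some z"
  obtains u' where "f_word i u = Some u'" "z = u' @ v" | v' where "f_word i v = Some v'" "z = u @ v'"
proof (cases "u = [] \<or> v = []")
  case True
  then show ?thesis using assms(2) that by auto
next
  case False
  then show ?thesis
    using assms(2) that f_word_append[OF assms(1), of u v] by (auto split: if_splits)
qed

text \<open>By the tensor product rule an operator acts inside one of the two factors.\<close>

lemma crystal_closed_append:
  assumes A: "crystal_closed m n A" and B: "crystal_closed m n B"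
  shows "crystal_closed m n {u @ v |u v. u \<in> A \<and> v \<in> B}" (is "crystal_closed m n ?AB")
  unfolding crystal_closed_def
proof (intro conjI ballI allI impI)
  have "?AB = (\<lambda>(u, v). u @ v) ` (A \<times> B)" by auto
  then show "finite ?AB" using crystal_closedD(1)[OF A] crystal_closedD(1)[OF B] by simp
  show "?AB \<subseteq> words m n"
    using crystal_closedD(2)[OF A] crystal_closedD(2)[OF B] by (fastforce simp: words_def)
  fix i x y assume i: "i \<in> simple_indices m n" and f: "f_word i x = Some y"
  show "x \<in> ?AB \<longleftrightarrow> y \<in> ?AB"
  proof
    assume "x \<in> ?AB"
    then obtain u v where x: "x = u @ v" "u \<in> A" "v \<in> B" by blast
    show "y \<in> ?AB"
    proof (rule f_word_append_cases[OF i f[unfolded x(1)]])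
      fix u' assume "f_word i u = Some u'" "y = u' @ v"
      then show ?thesis using x(2,3) crystal_closedD(3)[OF A i, of u u'] by blast
    next
      fix v' assume "f_word i v = Some v'" "y = u @ v'"
      then show ?thesis using x(2,3) crystal_closedD(3)[OF B i, of v v'] by blast
    qed
  next
    assume "y \<in> ?AB"
    then obtain u v where y: "y = u @ v" "u \<in> A" "v \<in> B" by blast
    \<comment> \<open>Operators preserve length and act within one part, so cutting x where y is cut
      recovers the factors.\<close>
    define p q where "p = take (length u) x" and "q = drop (length u) x"
    have x: "x = p @ q" by (simp add: p_def q_def)
    have "length x = length y" using length_f_word[OF f] by simp
    then have lp: "length p = length u" by (simp add: p_def y(1))
    show "x \<in> ?AB"
    proof (rule f_word_append_cases[OF i f[unfolded x]])
      fix p' assume p': "f_word i p = Some p'" "y = p' @ q"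
      then have "p' = u" "q = v" using y(1) lp length_f_word[OF p'(1)] by simp_all
      then show ?thesis using p' y(2,3) x crystal_closedD(3)[OF A i p'(1)] by blast
    next
      fix q' assume q': "f_word i q = Some q'" "y = p @ q'"
      then have "p = u" "q' = v" using y(1) lp by simp_all
      then show ?thesis using q' y(2,3) x crystal_closedD(3)[OF B i q'(1)] by blast
    qed
  qed
qed

text \<open>The order is compatible with addition, and a strict drop in one factor makes the sum
  drop strictly.\<close>

lemma leading_set_add:
  assumes "leading_set m n \<mu> A" "leading_set m n \<nu> B"
  shows "leading_set m n (\<mu> + \<nu>) {u @ v |u v. u \<in> A \<and> v \<in> B}"
proof -
  obtain a where a: "a \<in> A" "expo a = \<mu>" "\<And>w. w \<in> A \<Longrightarrow> length w = length a"
     "\<And>w. w \<in> A \<Longrightarrow> w \<noteq> a \<Longrightarrow> expo w < \<mu>"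
    using assms(1) unfolding leading_set_def by blast
  obtain b where b: "b \<in> B" "expo b = \<nu>" "\<And>w. w \<in> B \<Longrightarrow> length w = length b"
     "\<And>w. w \<in> B \<Longrightarrow> w \<noteq> b \<Longrightarrow> expo w < \<nu>"
    using assms(2) unfolding leading_set_def by blast
  show ?thesis
    unfolding leading_set_def
  proof (intro conjI bexI[of _ "a @ b"] ballI)
    show "crystal_closed m n {u @ v |u v. u \<in> A \<and> v \<in> B}"
      using assms crystal_closed_append unfolding leading_set_def by blast
    show "expo (a @ b) = \<mu> + \<nu>" using a(2) b(2) by simp
    show "a @ b \<in> {u @ v |u v. u \<in> A \<and> v \<in> B}" using a(1) b(1) by blast
    fix w assume "w \<in> {u @ v |u v. u \<in> A \<and> v \<in> B}"
    then obtain u v where w: "w = u @ v" "u \<in> A" "v \<in> B" by blast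
    show "length w = length (a @ b)" using w a(3)[OF w(2)] b(3)[OF w(3)] by simp
    show "w \<noteq> a @ b \<longrightarrow> expo w < \<mu> + \<nu>"
    proof
      assume "w \<noteq> a @ b"
      have "u = a \<or> expo u < \<mu>" using a(4)[OF w(2)] by blast
      moreover have "v = b \<or> expo v < \<nu>" using b(4)[OF w(3)] by blast
      ultimately consider "expo u < \<mu>" "expo v \<le> \<nu>" | "expo u \<le> \<mu>" "expo v < \<nu>"
        using a(2) b(2) w(1) \<open>w \<noteq> a @ b\<close> by force
      then show "expo w < \<mu> + \<nu>"
        by cases (simp_all add: w(1) add_less_le_mono add_le_less_mono)
    qed
  qed
qed

section \<open>Closed sets with a given dominant leading exponent\<close>

definition dominant :: "nat \<Rightarrow> rat \<Rightarrow> (rat \<Rightarrow>\<^sub>0 nat) \<Rightarrow> bool" where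
  "dominant m n \<mu> \<longleftrightarrow> Poly_Mapping.keys \<mu> \<subseteq> letters_upto m n \<and>
     (\<forall>i\<in>simple_indices m n.
        (Poly_Mapping.lookup \<mu> (lower_letter i) = 0 \<longrightarrow> Poly_Mapping.lookup \<mu> (upper_letter i) = 0) \<and>
        (i < 0 \<longrightarrow> Poly_Mapping.lookup \<mu> (upper_letter i) \<le> Poly_Mapping.lookup \<mu> (lower_letter i)))"

lemma ex_source_word:
  assumes keys: "Poly_Mapping.keys \<mu> \<subseteq> letters_upto m n"
    and i: "\<And>i. i \<in> simple_indices m n \<Longrightarrow>
      Poly_Mapping.lookup \<mu> (lower_letter i) = 0 \<Longrightarrow> Poly_Mapping.lookup \<mu> (upper_letter i) = 0"
    and neg: "\<And>b. b < 0 \<Longrightarrow> Poly_Mapping.lookup \<mu> b \<le> 1"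
  shows "\<exists>w. source_word m n w \<and> expo w = \<mu>"
proof -
  obtain z where z: "z \<in> lists (letters_upto m n)" "expo z = \<mu>" using ex_word_expo[OF keys] by blast
  define w where "w = sort_key source_key z"
  have "mset w = mset z" by (simp add: w_def)
  then have cnt: "count_list w b = Poly_Mapping.lookup \<mu> b" for b
    unfolding z(2)[symmetric] lookup_expo by (simp flip: count_mset)
  have set: "b \<in> set w \<longleftrightarrow> Poly_Mapping.lookup \<mu> b \<noteq> 0" for b
    unfolding cnt[symmetric] by (simp add: count_list_0_iff)
  have "source_word m n w"
    unfolding source_word_def
  proof (intro conjI ballI impI allI)
    show "w \<in> words m n" using z(1) by (simp add: w_def words_def in_lists_conv_set)
    show "sorted (map source_key w)" by (simp add: w_def)
    show "count_list w b \<le> 1" if "b < 0" for b using neg[OF that] cnt by simp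
    show "lower_letter j \<in> set w" if "j \<in> simple_indices m n" "upper_letter j \<in> set w" for j
      using i[OF that(1)] that(2) set by blast
  qed
  moreover have "expo w = \<mu>" by (rule poly_mapping_eqI) (simp add: lookup_expo cnt)
  ultimately show ?thesis by blast
qed

text \<open>A dominant exponent is peeled off column by column: the source word takes one copy of each
  negative letter and all the positive letters.\<close>

lemma ex_leading_set:
  assumes n: "0 < n" "2 * n \<in> \<int>" and "dominant m n \<mu>"
  shows "\<exists>X. leading_set m n \<mu> X"
  using assms(3)
proof (induction "\<Sum>b\<in>letters_upto m n. Poly_Mapping.lookup \<mu> b" arbitrary: \<mu> rule: less_induct)
  case less
  have keys: "Poly_Mapping.keys \<mu> \<subseteq> letters_upto m n"
    and dom: "\<And>i. i \<in> simple_indices m n \<Longrightarrow>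
      Poly_Mapping.lookup \<mu> (lower_letter i) = 0 \<Longrightarrow> Poly_Mapping.lookup \<mu> (upper_letter i) = 0"
    and decr: "\<And>i. i \<in> simple_indices m n \<Longrightarrow> i < 0 \<Longrightarrow>
      Poly_Mapping.lookup \<mu> (upper_letter i) \<le> Poly_Mapping.lookup \<mu> (lower_letter i)"
    using less.prems unfolding dominant_def by blast+
  show ?case
  proof (cases "\<mu> = 0")
    case True
    then show ?thesis using leading_set_Nil by blast
  next
    case False
    define k where "k b = (if b < 0 then min 1 (Poly_Mapping.lookup \<mu> b) else Poly_Mapping.lookup \<mu> b)" for b :: rat
    define \<kappa> where "\<kappa> = (\<Sum>b\<in>Poly_Mapping.keys \<mu>. Poly_Mapping.single b (k b))"
    have k0: "k b = 0 \<longleftrightarrow> Poly_Mapping.lookup \<mu> b = 0" for b by (simp add: k_def min_def)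
    have k_le: "k b \<le> Poly_Mapping.lookup \<mu> b" for b by (simp add: k_def)
    have \<kappa>: "Poly_Mapping.lookup \<kappa> b = k b" for b
    proof -
      have "Poly_Mapping.lookup \<kappa> b = (\<Sum>c\<in>Poly_Mapping.keys \<mu>. if c = b then k c else 0)"
        by (simp add: \<kappa>_def lookup_sum lookup_single when_def)
      also have "\<dots> = (if b \<in> Poly_Mapping.keys \<mu> then k b else 0)" by simp
      also have "\<dots> = k b" by (simp add: k0 in_keys_iff)
      finally show ?thesis .
    qed
    have "\<exists>w. source_word m n w \<and> expo w = \<kappa>"
    proof (rule ex_source_word)
      show "Poly_Mapping.keys \<kappa> \<subseteq> letters_upto m n" using keys by (auto simp: in_keys_iff \<kappa> k0)
      show "Poly_Mapping.lookup \<kappa> (upper_letter i) = 0"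
        if "i \<in> simple_indices m n" "Poly_Mapping.lookup \<kappa> (lower_letter i) = 0" for i
        using dom[OF that(1)] that(2) unfolding \<kappa> k0 by blast
      show "Poly_Mapping.lookup \<kappa> b \<le> 1" if "b < 0" for b using that by (simp add: \<kappa> k_def)
    qed
    then obtain w where w: "source_word m n w" "expo w = \<kappa>" by blast
    have sum: "\<mu> = \<kappa> + (\<mu> - \<kappa>)"
      by (rule poly_mapping_eqI) (simp add: lookup_add lookup_minus \<kappa> k_le)
    have nonneg: "k b = Poly_Mapping.lookup \<mu> b" if "\<not> b < 0" for b using that by (simp add: k_def)
    \<comment> \<open>No positive letters remain. Lowering every nonzero negative exponent by 1
      keeps them decreasing, which also gives the support condition there.\<close>
    have "dominant m n (\<mu> - \<kappa>)"
      unfolding dominant_def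
    proof (intro conjI ballI impI)
      show "Poly_Mapping.keys (\<mu> - \<kappa>) \<subseteq> letters_upto m n"
        using keys by (auto simp: in_keys_iff lookup_minus)
      fix i assume i: "i \<in> simple_indices m n"
      show le: "Poly_Mapping.lookup (\<mu> - \<kappa>) (upper_letter i) \<le> Poly_Mapping.lookup (\<mu> - \<kappa>) (lower_letter i)"
        if "i < 0"
      proof -
        have "lower_letter i < 0" "upper_letter i < 0"
          using that by (simp_all add: lower_letter_def upper_letter_def)
        then show ?thesis using decr[OF i that] by (simp add: lookup_minus \<kappa> k_def)
      qed
      assume *: "Poly_Mapping.lookup (\<mu> - \<kappa>) (lower_letter i) = 0"
      show "Poly_Mapping.lookup (\<mu> - \<kappa>) (upper_letter i) = 0"
      proof (cases "i < 0")
        case True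
        then show ?thesis using le * by simp
      next
        case False
        then have "\<not> upper_letter i < 0" by (simp add: upper_letter_def)
        then show ?thesis by (simp add: lookup_minus \<kappa> nonneg)
      qed
    qed
    moreover have "(\<Sum>b\<in>letters_upto m n. Poly_Mapping.lookup (\<mu> - \<kappa>) b) <
        (\<Sum>b\<in>letters_upto m n. Poly_Mapping.lookup \<mu> b)"
    proof (rule sum_strict_mono_ex1)
      have "Poly_Mapping.keys \<mu> \<noteq> {}"
      proof
        assume "Poly_Mapping.keys \<mu> = {}"
        then have "Poly_Mapping.lookup \<mu> b = 0" for b
          using not_in_keys_iff_lookup_eq_zero[of b \<mu>] by simp
        then have "\<mu> = 0" by (intro poly_mapping_eqI) simp
        with False show False by simp
      qed
      then obtain b where b: "b \<in> Poly_Mapping.keys \<mu>" by blast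
      then have pos: "0 < Poly_Mapping.lookup \<mu> b" unfolding in_keys_iff by (rule neq0_conv[THEN iffD1])
      then have "0 < k b" using k0[of b] by linarith
      then have "Poly_Mapping.lookup \<mu> b - k b < Poly_Mapping.lookup \<mu> b" using pos by (rule diff_less)
      then have "Poly_Mapping.lookup (\<mu> - \<kappa>) b < Poly_Mapping.lookup \<mu> b" unfolding lookup_minus \<kappa> .
      moreover have "b \<in> letters_upto m n" using keys b by (rule subsetD)
      ultimately show "\<exists>b\<in>letters_upto m n. Poly_Mapping.lookup (\<mu> - \<kappa>) b < Poly_Mapping.lookup \<mu> b" by (rule bexI)
    qed (simp_all add: finite_letters_upto lookup_minus)
    ultimately obtain Y where "leading_set m n (\<mu> - \<kappa>) Y" using less.hyps by blast
    then show ?thesis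
      using leading_set_add[OF leading_set_source_word[OF n w(1)] \<open>leading_set m n (\<mu> - \<kappa>) Y\<close>]
      unfolding w(2) sum[symmetric] by blast
  qed
qed

section \<open>Leading exponents of polynomials satisfying the conditions\<close>

lemma of_int_times_single: "of_int c * Poly_Mapping.single \<kappa> (1::int) = Poly_Mapping.single \<kappa> c"
  for \<kappa> :: "'a::monoid_add"
  by (simp add: mult_single flip: single_of_int)

lemma prod_const_poly: "(\<Prod>b\<in>A. [:h b:]) = [:\<Prod>b\<in>A. h b:]"
  by (induction A rule: infinite_finite_induct) (simp_all add: one_pCons mult.commute)

text \<open>If \<open>z\<^sub>s\<close> but not \<open>z\<^sub>r\<close> occurs in the leading monomial, no other monomial can cancel the
  contribution of the leading one to the specialization.\<close>

lemma specialize_leading_not_independent: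
  assumes rs: "r < s" and \<mu>: "\<mu> \<in> Poly_Mapping.keys f" "Poly_Mapping.lookup \<mu> r = 0" "Poly_Mapping.lookup \<mu> s \<noteq> 0"
    and max: "\<And>\<nu>. \<nu> \<in> Poly_Mapping.keys f \<Longrightarrow> \<nu> \<le> \<mu>"
  shows "\<not> independent_of_t (specialize r s f)"
proof -
  define g where "g = (\<lambda>b. if b = r then [:0, 1:] else if b = s then - [:0, 1:] else [:zvar b:])"
  \<comment> \<open>The monomial left in the other variables; the exponents of r and s merge into
    the power of t.\<close>
  define rest where "rest \<nu> = (\<Sum>b\<in>Poly_Mapping.keys \<nu> - {r, s}. Poly_Mapping.single b (Poly_Mapping.lookup \<nu> b))"
    for \<nu> :: "rat \<Rightarrow>\<^sub>0 nat"
  let ?d = "\<lambda>\<nu>. Poly_Mapping.lookup \<nu> r + Poly_Mapping.lookup \<nu> s"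
  let ?c = "\<lambda>\<nu>. Poly_Mapping.lookup f \<nu> * (-1) ^ Poly_Mapping.lookup \<nu> s"
  have rest: "Poly_Mapping.lookup (rest \<nu>) b = (if b \<in> {r, s} then 0 else Poly_Mapping.lookup \<nu> b)" for \<nu> b
  proof -
    have "Poly_Mapping.lookup (rest \<nu>) b =
        (\<Sum>c\<in>Poly_Mapping.keys \<nu> - {r, s}. if c = b then Poly_Mapping.lookup \<nu> c else 0)"
      by (simp add: rest_def lookup_sum lookup_single when_def)
    also have "\<dots> = (if b \<in> Poly_Mapping.keys \<nu> - {r, s} then Poly_Mapping.lookup \<nu> b else 0)" by simp
    also have "\<dots> = (if b \<in> {r, s} then 0 else Poly_Mapping.lookup \<nu> b)" by (simp add: in_keys_iff)
    finally show ?thesis .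
  qed
  have mono: "(\<Prod>b\<in>Poly_Mapping.keys \<nu>. g b ^ Poly_Mapping.lookup \<nu> b) =
      monom ((-1) ^ Poly_Mapping.lookup \<nu> s * Poly_Mapping.single (rest \<nu>) 1) (?d \<nu>)" for \<nu>
  proof -
    let ?K = "Poly_Mapping.keys \<nu> - {r, s}"
    have "(\<Prod>b\<in>Poly_Mapping.keys \<nu>. g b ^ Poly_Mapping.lookup \<nu> b) =
        (\<Prod>b\<in>insert r (insert s ?K). g b ^ Poly_Mapping.lookup \<nu> b)"
      by (rule prod.mono_neutral_left) (auto simp: in_keys_iff)
    also have "\<dots> = g r ^ Poly_Mapping.lookup \<nu> r * (g s ^ Poly_Mapping.lookup \<nu> s *
        (\<Prod>b\<in>?K. g b ^ Poly_Mapping.lookup \<nu> b))"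
      using rs by simp
    also have "g r ^ Poly_Mapping.lookup \<nu> r = monom 1 (Poly_Mapping.lookup \<nu> r)"
      by (simp add: g_def monom_altdef)
    also have "g s = monom (-1) 1" using rs by (simp add: g_def monom_altdef)
    also have "monom (-1) 1 ^ Poly_Mapping.lookup \<nu> s = monom ((-1) ^ Poly_Mapping.lookup \<nu> s) (Poly_Mapping.lookup \<nu> s)"
      by (simp add: monom_power)
    also have "(\<Prod>b\<in>?K. g b ^ Poly_Mapping.lookup \<nu> b) = (\<Prod>b\<in>?K. [:zvar b ^ Poly_Mapping.lookup \<nu> b:])"
      by (rule prod.cong) (auto simp: g_def poly_const_pow)
    also have "\<dots> = monom (Poly_Mapping.single (rest \<nu>) 1) 0"
      by (simp add: prod_const_poly prod_zvar rest_def monom_0)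
    finally show ?thesis by (simp add: mult_monom)
  qed
  have scal: "of_int c * ((-1) ^ j * Poly_Mapping.single \<kappa> (1::int)) = Poly_Mapping.single \<kappa> (c * (-1) ^ j)"
    for c j and \<kappa> :: "rat \<Rightarrow>\<^sub>0 nat"
  proof -
    have "of_int c * ((-1) ^ j * Poly_Mapping.single \<kappa> (1::int)) = of_int (c * (-1) ^ j) * Poly_Mapping.single \<kappa> 1"
      by (simp add: mult.assoc)
    also have "\<dots> = Poly_Mapping.single \<kappa> (c * (-1) ^ j)" by (rule of_int_times_single)
    finally show ?thesis .
  qed
  have monom_scale: "of_int c * monom p d = monom (of_int c * p) d" for c p and d
    by (metis (no_types) mult.left_neutral mult_monom add_0 monom_0 of_int_poly)
  have sp: "specialize r s f = (\<Sum>\<nu>\<in>Poly_Mapping.keys f. monom (Poly_Mapping.single (rest \<nu>) (?c \<nu>)) (?d \<nu>))"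
    unfolding specialize_def g_def[symmetric] zsubst_def mono monom_scale scal ..
  \<comment> \<open>A competitor agrees with \<mu> away from r and s. If it contained r, it would
    exceed \<mu> at r, the smaller of the two letters, and beat the maximum; otherwise the power of
    t fixes its exponent at s.\<close>
  have uniq: "\<nu> = \<mu>" if \<nu>: "\<nu> \<in> Poly_Mapping.keys f" "?d \<nu> = Poly_Mapping.lookup \<mu> s" "rest \<nu> = rest \<mu>" for \<nu>
  proof -
    have same: "Poly_Mapping.lookup \<nu> b = Poly_Mapping.lookup \<mu> b" if "b \<noteq> r" "b \<noteq> s" for b
      using rest[of \<nu> b] rest[of \<mu> b] that \<nu>(3) by simp
    show ?thesis
    proof (cases "Poly_Mapping.lookup \<nu> r = 0")
      case True
      then show ?thesis using same \<nu>(2) \<mu>(2) by (intro poly_mapping_eqI) (metis add_0)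
    next
      case False
      have "less_fun (Poly_Mapping.lookup \<mu>) (Poly_Mapping.lookup \<nu>)"
        unfolding less_fun_def using False \<mu>(2) same rs by (intro exI[of _ r]) auto
      then have "\<mu> < \<nu>" by (simp add: less_poly_mapping.rep_eq)
      then show ?thesis using max[OF \<nu>(1)] by simp
    qed
  qed
  have "Poly_Mapping.lookup (coeff (specialize r s f) (Poly_Mapping.lookup \<mu> s)) (rest \<mu>) =
      (\<Sum>\<nu>\<in>Poly_Mapping.keys f. if ?d \<nu> = Poly_Mapping.lookup \<mu> s \<and> rest \<nu> = rest \<mu> then ?c \<nu> else 0)"
    unfolding sp coeff_sum lookup_sum by (rule sum.cong) (auto simp: lookup_single when_def)
  also have "\<dots> = (\<Sum>\<nu>\<in>Poly_Mapping.keys f. if \<nu> = \<mu> then ?c \<nu> else 0)"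
    using uniq \<mu>(2) by (intro sum.cong if_cong) auto
  also have "\<dots> = ?c \<mu>" using \<mu>(1) by simp
  also have "\<dots> \<noteq> 0" using \<mu>(1) by (simp add: in_keys_iff)
  finally have "coeff (specialize r s f) (Poly_Mapping.lookup \<mu> s) \<noteq> 0" by auto
  then have "Poly_Mapping.lookup \<mu> s \<le> degree (specialize r s f)" by (rule le_degree)
  then show ?thesis using \<mu>(3) by (simp add: independent_of_t_def)
qed

text \<open>If exponents increased at a negative root, swapping them would give a larger monomial
  with the same coefficient. A violation of the support condition at i \<ge> 0 would leave a power
  of t.\<close>

lemma character_like_leading_dominant:
  assumes n: "0 < n" "2 * n \<in> \<int>" and f: "character_like m n f" "f \<in> zpolys_in (letters_upto m n)"
    and \<mu>: "\<mu> \<in> Poly_Mapping.keys f" and max: "\<And>\<nu>. \<nu> \<in> Poly_Mapping.keys f \<Longrightarrow> \<nu> \<le> \<mu>"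
  shows "dominant m n \<mu>"
  unfolding dominant_def
proof (intro conjI ballI impI)
  show "Poly_Mapping.keys \<mu> \<subseteq> letters_upto m n" using f(2) \<mu> by (simp add: zpolys_in_def)
  fix i assume i: "i \<in> simple_indices m n"
  note lu = lower_less_upper[of i]
  show decr: "Poly_Mapping.lookup \<mu> (upper_letter i) \<le> Poly_Mapping.lookup \<mu> (lower_letter i)" if "i < 0"
  proof (rule ccontr)
    assume lt: "\<not> Poly_Mapping.lookup \<mu> (upper_letter i) \<le> Poly_Mapping.lookup \<mu> (lower_letter i)"
    let ?t = "Transposition.transpose (lower_letter i) (upper_letter i)"
    define \<nu> where "\<nu> = Poly_Mapping.map_key ?t \<mu>"
    have \<nu>: "Poly_Mapping.lookup \<nu> b = Poly_Mapping.lookup \<mu> (?t b)" for b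
      by (simp add: \<nu>_def map_key.rep_eq)
    have "expo_invariant f ?t" using f(1) i that unfolding character_like_def by metis
    then have "Poly_Mapping.lookup f \<nu> = Poly_Mapping.lookup f \<mu>"
      using \<nu> unfolding expo_invariant_def by blast
    then have "\<nu> \<le> \<mu>" using \<mu> max[of \<nu>] by (simp add: in_keys_iff)
    moreover have "less_fun (Poly_Mapping.lookup \<mu>) (Poly_Mapping.lookup \<nu>)"
      unfolding less_fun_def \<nu>
    proof (intro exI[of _ "lower_letter i"] conjI allI impI)
      show "Poly_Mapping.lookup \<mu> (lower_letter i) < Poly_Mapping.lookup \<mu> (?t (lower_letter i))"
        using lt by simp
      fix b assume "b < lower_letter i"
      then have "?t b = b" using lu by (intro transpose_apply_other) auto
      then show "Poly_Mapping.lookup \<mu> b = Poly_Mapping.lookup \<mu> (?t b)" by simp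
    qed
    then have "\<mu> < \<nu>" by (simp add: less_poly_mapping.rep_eq)
    ultimately show False by simp
  qed
  assume lo: "Poly_Mapping.lookup \<mu> (lower_letter i) = 0"
  show "Poly_Mapping.lookup \<mu> (upper_letter i) = 0"
  proof (cases "i < 0")
    case True
    then show ?thesis using decr lo by simp
  next
    case False
    then have "independent_of_t (specialize (lower_letter i) (upper_letter i) f)"
      using f(1) i unfolding character_like_def by metis
    then show ?thesis using specialize_leading_not_independent[OF lu \<mu> lo _ max] by blast
  qed
qed

text \<open>Subtracting a multiple of the character of a leading set removes the leading monomial, and all
  monomials stay in the finite set of exponents of words of bounded length.\<close>

lemma character_like_in_char_span_bounded:
  assumes n: "0 < n" "2 * n \<in> \<int>" and "character_like m n f"
    and "Poly_Mapping.keys f \<subseteq> expo ` {w \<in> words m n. length w \<le> d}"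
  shows "f \<in> char_span m n"
  using assms(3,4)
\<comment> \<open>The measure counts the possible exponents up to the leading one; f itself need not
  be homogeneous.\<close>
proof (induction "card {\<nu> \<in> expo ` {w \<in> words m n. length w \<le> d}. \<exists>\<kappa>\<in>Poly_Mapping.keys f. \<nu> \<le> \<kappa>}"
    arbitrary: f rule: less_induct)
  case less
  let ?D = "expo ` {w \<in> words m n. length w \<le> d}"
  have "{w \<in> words m n. length w \<le> d} = {w. set w \<subseteq> letters_upto m n \<and> length w \<le> d}"
    by (auto simp: words_def)
  then have finD: "finite ?D" by (simp add: finite_lists_length_le finite_letters_upto)
  show ?case
  proof (cases "f = 0")
    case True
    then show ?thesis by (simp add: char_span_def zscale.span_zero)
  next
    case False
    define \<mu> where "\<mu> = Max (Poly_Mapping.keys f)"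
    have \<mu>: "\<mu> \<in> Poly_Mapping.keys f" using False by (simp add: \<mu>_def)
    have max: "\<nu> \<le> \<mu>" if "\<nu> \<in> Poly_Mapping.keys f" for \<nu> using that by (simp add: \<mu>_def)
    have "f \<in> zpolys_in (letters_upto m n)"
      using less.prems(2) unfolding zpolys_in_def by (force simp: keys_expo words_def)
    then have "dominant m n \<mu>"
      using character_like_leading_dominant[OF n less.prems(1) _ \<mu> max] by blast
    then obtain X where X: "leading_set m n \<mu> X" using ex_leading_set[OF n] by blast
    then have closed: "crystal_closed m n X" by (simp add: leading_set_def)
    obtain w where w: "w \<in> X" "expo w = \<mu>" "\<And>w'. w' \<in> X \<Longrightarrow> length w' = length w"
      "\<And>w'. w' \<in> X \<Longrightarrow> w' \<noteq> w \<Longrightarrow> expo w' < \<mu>"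
      using X unfolding leading_set_def by blast
    note chX = lookup_ch[OF crystal_closedD(1)[OF closed]]
    have "{w' \<in> X. expo w' = \<mu>} = {w}" using w(1,2,4) by fastforce
    then have lead: "Poly_Mapping.lookup (ch X) \<mu> = 1" by (simp add: chX)
    obtain z where z: "z \<in> words m n" "length z \<le> d" "expo z = \<mu>" using \<mu> less.prems(2) by auto
    \<comment> \<open>The exponent determines the length, so all words of X are as long as z, and z
      obeys the bound d.\<close>
    have keysX: "\<nu> \<in> ?D \<and> \<nu> \<le> \<mu>" if "\<nu> \<in> Poly_Mapping.keys (ch X)" for \<nu>
    proof -
      have "card {w' \<in> X. expo w' = \<nu>} \<noteq> 0" using that by (simp add: in_keys_iff chX)
      then have "{w' \<in> X. expo w' = \<nu>} \<noteq> {}" by (metis card.empty)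
      then obtain w' where w': "w' \<in> X" "expo w' = \<nu>" by blast
      have "length w' \<le> d" using w(3)[OF w'(1)] expo_eq_imp_length[of w z] w(2) z by simp
      moreover have "w' \<in> words m n" using crystal_closedD(2)[OF closed] w'(1) by blast
      moreover have "\<nu> \<le> \<mu>" using w(2) w(4)[OF w'(1)] w'(2) by (cases "w' = w") auto
      ultimately show ?thesis using w'(2) by blast
    qed
    define f' where "f' = f + zscale (- Poly_Mapping.lookup f \<mu>) (ch X)"
    have lookup': "Poly_Mapping.lookup f' \<nu> = Poly_Mapping.lookup f \<nu> - Poly_Mapping.lookup f \<mu> * Poly_Mapping.lookup (ch X) \<nu>" for \<nu>
      unfolding f'_def lookup_add lookup_zscale by simp
    have keys': "\<nu> \<in> ?D \<and> \<nu> < \<mu>" if "\<nu> \<in> Poly_Mapping.keys f'" for \<nu>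
    proof -
      have "\<nu> \<in> Poly_Mapping.keys f \<or> \<nu> \<in> Poly_Mapping.keys (ch X)"
        using that by (auto simp: in_keys_iff lookup')
      then have "\<nu> \<in> ?D" "\<nu> \<le> \<mu>" using keysX max less.prems(2) by blast+
      moreover have "\<nu> \<noteq> \<mu>" using that lead by (auto simp: in_keys_iff lookup')
      ultimately show ?thesis using order.not_eq_order_implies_strict[of \<nu> \<mu>] by blast
    qed
    have "{\<nu> \<in> ?D. \<exists>\<kappa>\<in>Poly_Mapping.keys f'. \<nu> \<le> \<kappa>} \<subset> {\<nu> \<in> ?D. \<exists>\<kappa>\<in>Poly_Mapping.keys f. \<nu> \<le> \<kappa>}"
    proof
      show "{\<nu> \<in> ?D. \<exists>\<kappa>\<in>Poly_Mapping.keys f'. \<nu> \<le> \<kappa>} \<subseteq> {\<nu> \<in> ?D. \<exists>\<kappa>\<in>Poly_Mapping.keys f. \<nu> \<le> \<kappa>}"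
        using keys' \<mu> by (blast intro: order.trans less_imp_le)
      have "\<mu> \<notin> {\<nu> \<in> ?D. \<exists>\<kappa>\<in>Poly_Mapping.keys f'. \<nu> \<le> \<kappa>}" using keys' by (auto simp: not_le)
      moreover have "\<mu> \<in> {\<nu> \<in> ?D. \<exists>\<kappa>\<in>Poly_Mapping.keys f. \<nu> \<le> \<kappa>}" using \<mu> less.prems(2) by blast
      ultimately show "{\<nu> \<in> ?D. \<exists>\<kappa>\<in>Poly_Mapping.keys f'. \<nu> \<le> \<kappa>} \<noteq> {\<nu> \<in> ?D. \<exists>\<kappa>\<in>Poly_Mapping.keys f. \<nu> \<le> \<kappa>}"
        by blast
    qed
    then have "card {\<nu> \<in> ?D. \<exists>\<kappa>\<in>Poly_Mapping.keys f'. \<nu> \<le> \<kappa>} < card {\<nu> \<in> ?D. \<exists>\<kappa>\<in>Poly_Mapping.keys f. \<nu> \<le> \<kappa>}"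
      using finD by (intro psubset_card_mono) auto
    moreover have "character_like m n f'"
      unfolding f'_def by (intro character_like_add character_like_zscale character_like_ch less.prems(1) closed)
    moreover have "Poly_Mapping.keys f' \<subseteq> ?D" using keys' by blast
    ultimately have "f' \<in> char_span m n" using less.hyps by blast
    moreover have "zscale (Poly_Mapping.lookup f \<mu>) (ch X) \<in> char_span m n"
      using ch_closed_in_char_span[OF closed] unfolding char_span_def by (rule zscale.span_scale)
    moreover have "f = f' + zscale (Poly_Mapping.lookup f \<mu>) (ch X)"
      by (rule poly_mapping_eqI) (simp add: lookup_add lookup')
    ultimately show ?thesis unfolding char_span_def using zscale.span_add[of f' _ "zscale (Poly_Mapping.lookup f \<mu>) (ch X)"] by simp
  qed
qed

lemma character_like_in_char_span:
  assumes n: "0 < n" "2 * n \<in> \<int>" and f: "character_like m n f" "f \<in> zpolys_in (letters_upto m n)"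
  shows "f \<in> char_span m n"
proof -
  have "\<exists>w\<in>words m n. expo w = \<mu>" if "\<mu> \<in> Poly_Mapping.keys f" for \<mu>
    using ex_word_expo[of \<mu> "letters_upto m n"] f(2) that by (auto simp: zpolys_in_def words_def)
  then obtain word where word: "\<And>\<mu>. \<mu> \<in> Poly_Mapping.keys f \<Longrightarrow> word \<mu> \<in> words m n \<and> expo (word \<mu>) = \<mu>"
    by metis
  \<comment> \<open>A crude common bound for the lengths of words representing the monomials of
    f.\<close>
  define d where "d = (\<Sum>\<mu>\<in>Poly_Mapping.keys f. length (word \<mu>))"
  have "length (word \<mu>) \<le> d" if "\<mu> \<in> Poly_Mapping.keys f" for \<mu>
    unfolding d_def using that by (intro member_le_sum) auto
  then have "Poly_Mapping.keys f \<subseteq> expo ` {w \<in> words m n. length w \<le> d}"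
    using word by (force simp: image_iff)
  then show ?thesis using character_like_in_char_span_bounded[OF n f(1)] by blast
qed

theorem theorem6p6:
  fixes m :: nat and n :: rat and f :: zpoly
  assumes "0 < n" and "2 * n \<in> \<int>"
    and "f \<in> zpolys_in (letters_upto m n)"
  shows "f \<in> char_span m n \<longleftrightarrow>
    symmetric_in {b \<in> letters_upto m n. b < 0} f \<and>
    (\<forall>r \<in> letters_upto m n. \<forall>s \<in> letters_upto m n.
       (r = -1 \<and> s = 1/2) \<or> (0 < r \<and> s = r + 1/2) \<longrightarrow>
       independent_of_t (specialize r s f))"
  using char_span_character_like[OF assms(1,2)] character_like_in_char_span[OF assms(1,2) _ assms(3)]
    character_like_iff[OF assms(1,2)] by blast

end
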